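(* Let $\mathbb{F}$ be an algebraically closed field of characteristic $p>2$, let $\lambda\in\mathbb{F}^p$ with $\lambda\neq0$, and let $L_{p,p}^{\lambda}$ be the restricted model filiform Lie superalgebra. Then $\dim H^2_*(L_{p,p}^{\lambda},\mathbb{F})=3p-1$ (restricted cohomology, $\mathbb F$ the $1$-dimensional trivial module), and the cohomology classes of the cocycles $$\{(\varphi,\varphi_* ),\ (0,X^i_* )\mid\varphi\in\Omega^4-\{X^{1,p},\varphi_{p+2}\},\ 1\le i\le p\}$$ form a basis, where $$\Omega^4=\{X^{1,p},\ X^1Y^p,\ \varphi_5,\varphi_7,\ldots,\varphi_{p+2},\ \psi_2,\ldots,\psi_p,\ \phi_2,\phi_4,\ldots,\phi_{p+1}\}$$ and for $i\in\{5,7,\ldots,p+2\}$, $2\le j\le p$ and $k\in\{2,4,\ldots,p+1\}$ $$\varphi_i=\sum_{r=2}^{\lfloor i/2\rfloor}(-1)^rX^{r,i-r},\quad \psi_j=\sum_{s=2}^{j}(-1)^sX^sY^{j-s+1},\quad \phi_k=\sum_{t=1}^{\frac k2-1}(-1)^tY^{t,k-t}+(-1)^{\frac k2}\tfrac12Y^{\frac k2,\frac k2}.$$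
   Context: $L_{p,p}^\lambda$, for $\lambda=(\lambda_1,\ldots,\lambda_p)\in\mathbb F^p$, is the Lie superalgebra with even basis $X_1,\ldots,X_p$, odd basis $Y_1,\ldots,Y_p$, super-brackets $[X_1,X_i]=X_{i+1}$ ($2\le i\le p-1$), $[X_1,Y_j]=Y_{j+1}$ ($1\le j\le p-1$), all other brackets of basis elements (not determined by super-skew-symmetry) being zero, and with $p$-map on the even part $(\sum_{k=1}^pa_kX_k)^{[p]}=(\sum_{k=1}^pa_k^p\lambda_k)X_p$; it is a restricted Lie superalgebra. Cochains with trivial coefficients, $L=L_{p,p}^\lambda$, $|x|$ the parity of $x$: $C^q(L;\mathbb F)=\mathrm{Hom}_{\mathbb F}(\bigwedge^qL,\mathbb F)$, where $\bigwedge^qL$ is the super-exterior power, i.e. $L^{\otimes q}$ modulo the span of the elements $\cdots\otimes x_k\otimes x_{k+1}\otimes\cdots+(-1)^{|x_k||x_{k+1}|}\cdots\otimes x_{k+1}\otimes x_k\otimes\cdots$. For $\varphi\in C^1(L;\mathbb F)$, $d^1\varphi(x,y)=-\varphi([x,y])$; for $\alpha\in C^2(L;\mathbb F)$, $$d^2\alpha(x_1,x_2,x_3)=-\alpha([x_1,x_2],x_3)+(-1)^{|x_2||x_3|}\alpha([x_1,x_3],x_2)-(-1)^{|x_1|(|x_2|+|x_3|)}\alpha([x_2,x_3],x_1).$$ Basis of $C^2(L;\mathbb F)$: $X^{i,j}$ ($1\le i<j\le p$), $X^kY^l$ ($1\le k,l\le p$), $Y^{s,t}$ ($1\le s\le t\le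 p$), where $X^{i,j}(X_i,X_j)=1=-X^{i,j}(X_j,X_i)$; $X^kY^l(X_k,Y_l)=1=-X^kY^l(Y_l,X_k)$; $Y^{s,t}(Y_s,Y_t)=Y^{s,t}(Y_t,Y_s)=1$ for $s<t$ and $Y^{s,s}(Y_s,Y_s)=2$; each vanishes on all other pairs of basis vectors. Restricted cohomology: write $[x_1,\ldots,x_r]=[[\cdots[[x_1,x_2],x_3],\cdots],x_r]$. A map $\omega:L_{\bar0}\to\mathbb F$ has the $*$-property with respect to $\varphi\in C^2(L;\mathbb F)$ if for all $c\in\mathbb F$, $x,y\in L_{\bar0}$: (i) $\omega(cx)=c^p\omega(x)$; (ii) $$\omega(x+y)=\omega(x)+\omega(y)+\sum_{\substack{x_i=x\text{ or }y\\ x_1=x,\ x_2=y}}\frac{1}{\sharp(x)}\varphi([x_1,\ldots,x_{p-1}],x_p),$$ the sum being over sequences $(x_1,\ldots,x_p)$ and $\sharp(x)$ the number of factors $x_i$ equal to $x$. $C^1_*(L;\mathbb F)=C^1(L;\mathbb F)$ and $C^2_*(L;\mathbb F)$ is the space of pairs $(\varphi,\omega)$ with $\varphi\in C^2(L;\mathbb F)$ and $\omega:L_{\bar0}\to\mathbb F$ having the $*$-property w.r.t. $\varphi$. For $\varphi\in C^1_*(L;\mathbb F)$: $d^1_*(\varphi)=(d^1\varphi,\mathrm{ind}^1(\varphi))$ with $\mathrm{ind}^1(\varphi)(x)=\varphi(x^{[p]})$. For $(\alpha,\beta)\in C^2_*(L;\mathbb F)$: $d^2_*(\alpha,\beta)=(d^2\alpha,\mathrm{ind}^2(\alpha,\beta))$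 with $\mathrm{ind}^2(\alpha,\beta)(x,y)=\alpha(x,y^{[p]})-\alpha([x,\underbrace{y,\ldots,y}_{p-1}],y)$ for $x,y\in L_{\bar0}$. $H^2_*(L,\mathbb F)=\mathrm{Ker}\,d^2_*/\mathrm{Im}\,d^1_*$. Notation: $X^k_*:L_{\bar0}\to\mathbb F$ is $X^k_*(\sum_{i=1}^pa_iX_i)=a_k^p$. For $\varphi\in C^2(L;\mathbb F)$, $\varphi_*:L_{\bar0}\to\mathbb F$ denotes the map that vanishes on the basis $X_1,\ldots,X_p$ and has the $*$-property w.r.t. $\varphi$. *)

theory Defs
  imports
    "HOL-Computational_Algebra.Computational_Algebra"
    "HOL-Algebra.AbelCoset"
    "HOL-Library.Function_Algebras"
    "HOL-Library.Product_Plus"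
    "Jordan_Normal_Form.VS_Connect"
begin

section \<open>The restricted model filiform Lie superalgebra\<close>

text \<open>
  Since the dimension depends on the characteristic, vectors are coordinate functions on an
  infinite supply of basis symbols, and the Lie superalgebra of parameter \<open>p\<close> is the set of those
  supported on the symbols with indices \<open>1, \<dots>, p\<close>. All maps out of it (cochains included) are
  total functions that are required to be \<open>0\<close> outside their domain, so that two maps are equal
  iff they agree on the domain, and the vector space operations on maps are pointwise.
\<close>

datatype gen = Xg nat | Yg nat

fun parity :: "gen \<Rightarrow> nat" where
  "parity (Xg _) = 0"
| "parity (Yg _) = 1"

type_synonym 'a elt = "gen \<Rightarrow> 'a"

definition gens :: "nat \<Rightarrow> gen set" where
  "gens p = Xg ` {1..p} \<union> Yg ` {1..p}"

definition Lpp :: "nat \<Rightarrow> 'a::field elt set" where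
  "Lpp p = {x. \<forall>g. g \<notin> gens p \<longrightarrow> x g = 0}"

definition Lhom :: "nat \<Rightarrow> nat \<Rightarrow> 'a::field elt set" where
  "Lhom p a = {x \<in> Lpp p. \<forall>g. parity g \<noteq> a \<longrightarrow> x g = 0}"

abbreviation Lev :: "nat \<Rightarrow> 'a::field elt set" where
  "Lev p \<equiv> Lhom p 0"

definition hcomp :: "nat \<Rightarrow> 'a::field elt \<Rightarrow> 'a elt" where
  "hcomp a x = (\<lambda>g. if parity g = a then x g else 0)"

definition scl :: "'a::field \<Rightarrow> 'a elt \<Rightarrow> 'a elt" where
  "scl c x = (\<lambda>g. c * x g)"

definition bvec :: "gen \<Rightarrow> 'a::field elt" where
  "bvec g = (\<lambda>h. if h = g then 1 else 0)"

fun gbr :: "nat \<Rightarrow> gen \<Rightarrow> gen \<Rightarrow> 'a::field elt" where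
  "gbr p (Xg i) (Xg j) =
     (if i = 1 \<and> 2 \<le> j \<and> j \<le> p - 1 then bvec (Xg (j + 1))
      else if j = 1 \<and> 2 \<le> i \<and> i \<le> p - 1 then - bvec (Xg (i + 1))
      else 0)"
| "gbr p (Xg i) (Yg j) = (if i = 1 \<and> 1 \<le> j \<and> j \<le> p - 1 then bvec (Yg (j + 1)) else 0)"
| "gbr p (Yg j) (Xg i) = (if i = 1 \<and> 1 \<le> j \<and> j \<le> p - 1 then - bvec (Yg (j + 1)) else 0)"
| "gbr p (Yg i) (Yg j) = 0"

definition br :: "nat \<Rightarrow> 'a::field elt \<Rightarrow> 'a elt \<Rightarrow> 'a elt" where
  "br p x y = (\<Sum>g\<in>gens p. \<Sum>h\<in>gens p. scl (x g * y h) (gbr p g h))"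

definition pmap :: "nat \<Rightarrow> (nat \<Rightarrow> 'a::field) \<Rightarrow> 'a elt \<Rightarrow> 'a elt" where
  "pmap p lam x = scl (\<Sum>k\<in>{1..p}. x (Xg k) ^ p * lam k) (bvec (Xg p))"

text \<open>The left-normed bracket \<open>[[\<dots>[[x\<^sub>1, x\<^sub>2], x\<^sub>3], \<dots>], x\<^sub>r]\<close> of a non-empty list.\<close>

definition lbr :: "nat \<Rightarrow> 'a::field elt list \<Rightarrow> 'a elt" where
  "lbr p xs = foldl (br p) (hd xs) (tl xs)"


section \<open>Ordinary cochains with trivial coefficients\<close>

type_synonym 'a form1 = "'a elt \<Rightarrow> 'a"
type_synonym 'a form2 = "'a elt \<Rightarrow> 'a elt \<Rightarrow> 'a"
type_synonym 'a form3 = "'a elt \<Rightarrow> 'a elt \<Rightarrow> 'a elt \<Rightarrow> 'a"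

definition linear_on_L :: "nat \<Rightarrow> 'a::field form1 \<Rightarrow> bool" where
  "linear_on_L p f \<longleftrightarrow>
     (\<forall>x\<in>Lpp p. \<forall>y\<in>Lpp p. f (x + y) = f x + f y) \<and>
     (\<forall>c. \<forall>x\<in>Lpp p. f (scl c x) = c * f x)"

definition C1 :: "nat \<Rightarrow> 'a::field form1 set" where
  "C1 p = {f. linear_on_L p f \<and> (\<forall>x. x \<notin> Lpp p \<longrightarrow> f x = 0)}"

text \<open>
  A linear functional on the super-exterior square is a bilinear form that is compatible with the
  relations \<open>x \<otimes> y + (-1)\<^bsup>|x||y|\<^esup> y \<otimes> x\<close> for homogeneous \<open>x\<close> and \<open>y\<close>.
\<close>

definition C2 :: "nat \<Rightarrow> 'a::field form2 set" where
  "C2 p = {f.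
     (\<forall>y\<in>Lpp p. linear_on_L p (\<lambda>x. f x y)) \<and>
     (\<forall>x\<in>Lpp p. linear_on_L p (f x)) \<and>
     (\<forall>a\<in>{0,1}. \<forall>b\<in>{0,1}. \<forall>x\<in>Lhom p a. \<forall>y\<in>Lhom p b.
        f x y + (-1) ^ (a * b) * f y x = 0) \<and>
     (\<forall>x y. x \<notin> Lpp p \<or> y \<notin> Lpp p \<longrightarrow> f x y = 0)}"

definition d1 :: "nat \<Rightarrow> 'a::field form1 \<Rightarrow> 'a form2" where
  "d1 p f = (\<lambda>x y. if x \<in> Lpp p \<and> y \<in> Lpp p then - f (br p x y) else 0)"

text \<open>
  The defining formula of \<open>d\<^sup>2\<close> refers to parities and so makes sense for homogeneous arguments, of
  parities \<open>a\<close>, \<open>b\<close>, \<open>c\<close>; it is extended multilinearly by splitting into homogeneous components.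
\<close>

definition d2_hom :: "nat \<Rightarrow> 'a::field form2 \<Rightarrow> nat \<Rightarrow> nat \<Rightarrow> nat \<Rightarrow> 'a form3" where
  "d2_hom p f a b c x y z =
     - f (br p x y) z + (-1) ^ (b * c) * f (br p x z) y
     - (-1) ^ (a * (b + c)) * f (br p y z) x"

definition d2 :: "nat \<Rightarrow> 'a::field form2 \<Rightarrow> 'a form3" where
  "d2 p f = (\<lambda>x y z.
     if x \<in> Lpp p \<and> y \<in> Lpp p \<and> z \<in> Lpp p
     then (\<Sum>a\<in>{0,1}. \<Sum>b\<in>{0,1}. \<Sum>c\<in>{0,1}. d2_hom p f a b c (hcomp a x) (hcomp b y) (hcomp c z))
     else 0)"

definition form_of :: "nat \<Rightarrow> (gen \<Rightarrow> gen \<Rightarrow> 'a::field) \<Rightarrow> 'a form2" where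
  "form_of p m = (\<lambda>x y.
     if x \<in> Lpp p \<and> y \<in> Lpp p
     then (\<Sum>g\<in>gens p. \<Sum>h\<in>gens p. x g * y h * m g h) else 0)"

definition XX :: "nat \<Rightarrow> nat \<Rightarrow> nat \<Rightarrow> 'a::field form2" where
  "XX p i j = form_of p (\<lambda>g h.
     if g = Xg i \<and> h = Xg j then 1 else if g = Xg j \<and> h = Xg i then - 1 else 0)"

definition XY :: "nat \<Rightarrow> nat \<Rightarrow> nat \<Rightarrow> 'a::field form2" where
  "XY p k l = form_of p (\<lambda>g h.
     if g = Xg k \<and> h = Yg l then 1 else if g = Yg l \<and> h = Xg k then - 1 else 0)"

definition YY :: "nat \<Rightarrow> nat \<Rightarrow> nat \<Rightarrow> 'a::field form2" where
  "YY p s t = form_of p (\<lambda>g h.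
     if g = Yg s \<and> h = Yg t \<or> g = Yg t \<and> h = Yg s then (if s = t then 2 else 1) else 0)"


section \<open>Restricted cochains and the restricted cohomology space\<close>

text \<open>
  The sequences \<open>(x\<^sub>1, \<dots>, x\<^sub>p)\<close> with \<open>x\<^sub>i = x\<close> or \<open>y\<close>, \<open>x\<^sub>1 = x\<close>, \<open>x\<^sub>2 = y\<close> are encoded by boolean
  lists, where \<open>True\<close> stands for \<open>x\<close>.
\<close>

definition choices :: "nat \<Rightarrow> bool list set" where
  "choices p = {bs. length bs = p \<and> bs ! 0 \<and> \<not> bs ! 1}"

definition star_sum :: "nat \<Rightarrow> 'a::field form2 \<Rightarrow> 'a elt \<Rightarrow> 'a elt \<Rightarrow> 'a" where
  "star_sum p f x y =
     (\<Sum>bs\<in>choices p. let xs = map (\<lambda>b. if b then x else y) bs in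
        1 / of_nat (count_list bs True) * f (lbr p (butlast xs)) (last xs))"

definition star_property :: "nat \<Rightarrow> 'a::field form2 \<Rightarrow> 'a form1 \<Rightarrow> bool" where
  "star_property p f w \<longleftrightarrow>
     (\<forall>c. \<forall>x\<in>Lev p. w (scl c x) = c ^ p * w x) \<and>
     (\<forall>x\<in>Lev p. \<forall>y\<in>Lev p. w (x + y) = w x + w y + star_sum p f x y)"

type_synonym 'a rform2 = "'a form2 \<times> 'a form1"

definition C2_star_set :: "nat \<Rightarrow> 'a::field rform2 set" where
  "C2_star_set p =
     {(f, w). f \<in> C2 p \<and> star_property p f w \<and> (\<forall>x. x \<notin> Lev p \<longrightarrow> w x = 0)}"

text \<open>The fields \<open>mult\<close> and \<open>one\<close> of the module record are irrelevant for modules.\<close>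

definition C2_star :: "nat \<Rightarrow> ('a::field, 'a rform2) module" where
  "C2_star p = \<lparr>carrier = C2_star_set p, mult = undefined, one = undefined, zero = 0, add = (+),
     smult = (\<lambda>c (f, w). (\<lambda>x y. c * f x y, \<lambda>x. c * w x))\<rparr>"

definition ind1 :: "nat \<Rightarrow> (nat \<Rightarrow> 'a::field) \<Rightarrow> 'a form1 \<Rightarrow> 'a form1" where
  "ind1 p lam f = (\<lambda>x. if x \<in> Lev p then f (pmap p lam x) else 0)"

definition d1_star :: "nat \<Rightarrow> (nat \<Rightarrow> 'a::field) \<Rightarrow> 'a form1 \<Rightarrow> 'a rform2" where
  "d1_star p lam f = (d1 p f, ind1 p lam f)"

definition ind2 :: "nat \<Rightarrow> (nat \<Rightarrow> 'a::field) \<Rightarrow> 'a form2 \<Rightarrow> 'a form1 \<Rightarrow> 'a form2" where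
  "ind2 p lam f w = (\<lambda>x y.
     if x \<in> Lev p \<and> y \<in> Lev p
     then f x (pmap p lam y) - f (lbr p (x # replicate (p - 1) y)) y else 0)"

definition d2_star :: "nat \<Rightarrow> (nat \<Rightarrow> 'a::field) \<Rightarrow> 'a rform2 \<Rightarrow> 'a form3 \<times> 'a form2" where
  "d2_star p lam = (\<lambda>(f, w). (d2 p f, ind2 p lam f w))"

definition Ker_d2_star :: "nat \<Rightarrow> (nat \<Rightarrow> 'a::field) \<Rightarrow> ('a, 'a rform2) module" where
  "Ker_d2_star p lam = (C2_star p)\<lparr>carrier := {u \<in> C2_star_set p. d2_star p lam u = 0}\<rparr>"

definition Im_d1_star :: "nat \<Rightarrow> (nat \<Rightarrow> 'a::field) \<Rightarrow> 'a rform2 set" where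
  "Im_d1_star p lam = d1_star p lam ` C1 p"

text \<open>The quotient of a module \<open>M\<close> by (the underlying set of) a submodule \<open>B\<close>.\<close>

definition quot_module :: "('a, 'b) module \<Rightarrow> 'b set \<Rightarrow> ('a, 'b set) module" where
  "quot_module M B = \<lparr>carrier = a_rcosets\<^bsub>M\<^esub> B, mult = undefined, one = undefined, zero = B,
     add = (\<lambda>U V. U <+>\<^bsub>M\<^esub> V), smult = (\<lambda>c U. \<Union>u\<in>U. B +>\<^bsub>M\<^esub> (c \<odot>\<^bsub>M\<^esub> u))\<rparr>"

definition H2_star :: "nat \<Rightarrow> (nat \<Rightarrow> 'a::field) \<Rightarrow> ('a, 'a rform2 set) module" where
  "H2_star p lam = quot_module (Ker_d2_star p lam) (Im_d1_star p lam)"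

definition cohom_class :: "nat \<Rightarrow> (nat \<Rightarrow> 'a::field) \<Rightarrow> 'a rform2 \<Rightarrow> 'a rform2 set" where
  "cohom_class p lam u = Im_d1_star p lam +>\<^bsub>Ker_d2_star p lam\<^esub> u"

definition X_star :: "nat \<Rightarrow> nat \<Rightarrow> 'a::field form1" where
  "X_star p k = (\<lambda>x. if x \<in> Lev p then x (Xg k) ^ p else 0)"

definition lower_star :: "nat \<Rightarrow> 'a::field form2 \<Rightarrow> 'a form1" where
  "lower_star p f = (THE w. star_property p f w \<and> (\<forall>i\<in>{1..p}. w (bvec (Xg i)) = 0) \<and>
     (\<forall>x. x \<notin> Lev p \<longrightarrow> w x = 0))"


section \<open>The distinguished cocycles\<close>

definition varphi_form :: "nat \<Rightarrow> nat \<Rightarrow> 'a::field form2" where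
  "varphi_form p i = (\<lambda>x y. \<Sum>r\<in>{2..i div 2}. (-1) ^ r * XX p r (i - r) x y)"

definition psi_form :: "nat \<Rightarrow> nat \<Rightarrow> 'a::field form2" where
  "psi_form p j = (\<lambda>x y. \<Sum>s\<in>{2..j}. (-1) ^ s * XY p s (j - s + 1) x y)"

definition phi_form :: "nat \<Rightarrow> nat \<Rightarrow> 'a::field form2" where
  "phi_form p k = (\<lambda>x y. (\<Sum>t\<in>{1..k div 2 - 1}. (-1) ^ t * YY p t (k - t) x y)
     + (-1) ^ (k div 2) * (1 / 2) * YY p (k div 2) (k div 2) x y)"

definition Omega4 :: "nat \<Rightarrow> 'a::field form2 set" where
  "Omega4 p = {XX p 1 p, XY p 1 p}
     \<union> varphi_form p ` {i \<in> {5..p + 2}. odd i}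
     \<union> psi_form p ` {2..p}
     \<union> phi_form p ` {k \<in> {2..p + 1}. even k}"

definition basis_cocycles :: "nat \<Rightarrow> 'a::field rform2 set" where
  "basis_cocycles p =
     {(f, lower_star p f) | f. f \<in> Omega4 p - {XX p 1 p, varphi_form p (p + 2)}}
     \<union> {(0, X_star p i) | i. i \<in> {1..p}}"

end

(*
  Write D for ad X_1, so that [x, y] = x_1 D y - y_1 D x with x_1, y_1 the coefficients of X_1.
  A 2-cochain f is then a cocycle iff f (D x) y + f x (D y) = 0 for x, y in the span of the basis
  vectors other than X_1. Left-normed brackets of p even elements vanish, so ind^2 reduces to
  f x (y^[p]), and since lambda is nonzero, the kernel of d^2_* forces f (X_i, X_p) = 0 for all i.
  A left-normed bracket of p - 1 even elements is a multiple of X_p; hence for such f the sum in the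
  star-property vanishes, w is just p-semilinear, and the starred companion of f is 0.
  By D-invariance f is determined by its values f (X_1, -), f (X_2, -) and f (Y_1, -). This yields
  3p - 1 linear functionals on the cocycles that are dual to the proposed basis and whose common
  kernel consists of the coboundaries.
*)
theory Submission
  imports Defs
begin


section \<open>Bases of quotients of subspaces\<close>

text \<open>The components of a coboundary are coupled: for a 1-cochain g, d^1 g (X_1, X_{p-1}) = -
  g(X_p), while ind^1 g (X_i) = \<lambda>_i g(X_p). Evaluation of w at X_i therefore does not vanish
  on coboundaries, and this functional is corrected by \<lambda>_i f(X_1, X_{p-1}). The parity
  conditions on indices come from moving D across: f(X_m, X_2) = (-1)^m f(X_2, X_m) contradicts
  skew-symmetry unless m is odd or the value is 0. On odd vectors f is symmetric, and f(Y_m, Y_1) =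
  (-1)^(m-1) f(Y_1, Y_m) again leaves only odd m. Mixed pairs have no such symmetry; there X_{p+1} =
  0 forces f(X_2, Y_p) = 0. X^{1,p} and varphi_{p+2} are the members of Omega^4 that do not vanish
  against X_p, at the pairs (X_1, X_p) and (X_2, X_p). What remains is counted by 1 + (p-3)/2 +
  (p-1) + (p+1)/2 + p = 3p - 1.\<close>

locale subspace_quotient = Vector_Spaces.vector_space scale
  for scale :: "'k::field \<Rightarrow> 'v::ab_group_add \<Rightarrow> 'v" (infixr \<open>*s\<close> 75) +
  fixes Z B :: "'v set" and M :: "('k, 'v) module"
  assumes Z_add: "u \<in> Z \<Longrightarrow> v \<in> Z \<Longrightarrow> u + v \<in> Z"
    and Z_scale: "u \<in> Z \<Longrightarrow> c *s u \<in> Z"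
    and B_sub: "B \<subseteq> Z"
    and B_zero: "0 \<in> B"
    and B_add: "u \<in> B \<Longrightarrow> v \<in> B \<Longrightarrow> u + v \<in> B"
    and B_scale: "u \<in> B \<Longrightarrow> c *s u \<in> B"
    and M_carrier: "carrier M = Z"
    and M_zero: "\<zero>\<^bsub>M\<^esub> = 0"
    and M_add: "u \<oplus>\<^bsub>M\<^esub> v = u + v"
    and M_smult: "c \<odot>\<^bsub>M\<^esub> u = c *s u"
begin

abbreviation Q :: "('k, 'v set) module" where
  "Q \<equiv> quot_module M B"

abbreviation cls :: "'v \<Rightarrow> 'v set" where
  "cls u \<equiv> B +>\<^bsub>M\<^esub> u"

lemma B_uminus: "u \<in> B \<Longrightarrow> - u \<in> B"
  using B_scale[of u "- 1"] by simp

lemma B_diff: "u \<in> B \<Longrightarrow> v \<in> B \<Longrightarrow> u - v \<in> B"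
  using B_add[of u "- v"] B_uminus[of v] by simp

text \<open>\<open>M\<close> takes its operations from the ambient vector space, so cosets can be
  tested by differences there, without conditions on carriers.\<close>

lemma mem_cls: "w \<in> cls u \<longleftrightarrow> w - u \<in> B"
proof
  assume "w - u \<in> B"
  then show "w \<in> cls u"
    unfolding a_r_coset_def' M_add by (intro UN_I[of "w - u"]) auto
qed (auto simp: a_r_coset_def' M_add)

lemma cls_eq_iff: "cls u = cls v \<longleftrightarrow> u - v \<in> B"
proof
  assume "cls u = cls v"
  then show "u - v \<in> B"
    using mem_cls[of u u] mem_cls[of u v] B_zero by auto
next
  assume uv: "u - v \<in> B"
  have "w - u \<in> B \<longleftrightarrow> w - v \<in> B" for w
    using B_add[of "w - u" "u - v"] B_diff[of "w - v" "u - v"] uv by auto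
  then show "cls u = cls v"
    by (auto simp: mem_cls)
qed

lemma Q_carrier: "carrier Q = cls ` Z"
  by (auto simp: quot_module_def A_RCOSETS_def' M_carrier)

lemma Q_zero: "\<zero>\<^bsub>Q\<^esub> = cls 0"
  by (auto simp: quot_module_def mem_cls)

lemma Q_add: "cls u \<oplus>\<^bsub>Q\<^esub> cls v = cls (u + v)"
proof -
  have "w \<in> cls u \<oplus>\<^bsub>Q\<^esub> cls v \<longleftrightarrow> w \<in> cls (u + v)" for w
  proof
    assume "w \<in> cls u \<oplus>\<^bsub>Q\<^esub> cls v"
    then obtain h k where "h - u \<in> B" "k - v \<in> B" "w = h + k"
      by (auto simp: quot_module_def set_add_def' M_add mem_cls)
    then show "w \<in> cls (u + v)"
      using B_add[of "h - u" "k - v"] by (simp add: mem_cls algebra_simps)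
  next
    assume "w \<in> cls (u + v)"
    then have "u \<in> cls u" "w - u \<in> cls v"
      using B_zero by (auto simp: mem_cls algebra_simps)
    then have "\<exists>h\<in>cls u. \<exists>k\<in>cls v. w = h + k"
      by (rule_tac bexI[where x = u], rule_tac bexI[where x = "w - u"]) simp_all
    then show "w \<in> cls u \<oplus>\<^bsub>Q\<^esub> cls v"
      by (simp add: quot_module_def set_add_def' M_add)
  qed
  then show ?thesis by (simp add: set_eq_iff)
qed

text \<open>\<open>quot_module\<close> scales a coset by uniting the cosets of all scaled
  representatives. These coincide because \<open>B\<close> is closed under scaling, and there is at
  least one because \<open>B\<close> contains 0.\<close>

lemma Q_smult: "c \<odot>\<^bsub>Q\<^esub> cls u = cls (c *s u)"
proof -
  have "cls (c *s w) = cls (c *s u)" if "w \<in> cls u" for w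
    using that B_scale[of "w - u" c] by (simp add: mem_cls cls_eq_iff scale_right_diff_distrib)
  moreover have "u \<in> cls u"
    using B_zero by (simp add: mem_cls)
  ultimately have "(\<Union>w\<in>cls u. cls (c *s w)) = cls (c *s u)"
    by blast
  then show ?thesis
    by (simp add: quot_module_def M_smult)
qed

lemma Z_zero: "0 \<in> Z"
  using B_zero B_sub by auto

lemma Q_abelian_group: "abelian_group Q"
proof (rule abelian_groupI)
  fix x assume "x \<in> carrier Q"
  then obtain u where u: "u \<in> Z" "x = cls u"
    by (auto simp: Q_carrier)
  then have "- u \<in> Z"
    using Z_scale[of u "- 1"] by simp
  then show "\<exists>y\<in>carrier Q. y \<oplus>\<^bsub>Q\<^esub> x = \<zero>\<^bsub>Q\<^esub>"
    using u by (intro bexI[of _ "cls (- u)"]) (auto simp: Q_add Q_zero Q_carrier)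
qed (use Z_add Z_zero in \<open>auto simp: Q_carrier Q_add Q_zero add_ac\<close>)

lemma Q_vectorspace: "vectorspace (class_ring :: 'k ring) Q"
proof -
  have "module (class_ring :: 'k ring) Q"
  proof (rule module.intro[OF class_cring.cring_axioms Q_abelian_group])
    show "module_axioms (class_ring :: 'k ring) Q"
      by unfold_locales
        (use Z_scale in \<open>auto simp: Q_carrier Q_add Q_smult scale_left_distrib scale_right_distrib\<close>)
  qed
  then show ?thesis
    by (intro vectorspace.intro class_field)
qed

lemma Q_finsum:
  assumes "finite I" "\<And>i. i \<in> I \<Longrightarrow> f i \<in> Z"
  shows "finsum Q (\<lambda>i. cls (f i)) I = cls (sum f I)"
proof -
  interpret abelian_group Q
    by (rule Q_abelian_group)
  show ?thesis
    using assms
  proof (induction I rule: finite_induct)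
    case (insert i I)
    then have "(\<lambda>i. cls (f i)) \<in> I \<rightarrow> carrier Q" "cls (f i) \<in> carrier Q"
      by (auto simp: Q_carrier)
    then show ?case
      using insert by (simp add: Q_add)
  qed (simp add: Q_zero)
qed

text \<open>The functionals vanish on \<open>B\<close> and so descend to \<open>Q\<close>. Duality
  gives independence and distinctness of the classes. For spanning, subtracting from z the
  combination with coefficients \<open>\<kappa> i z\<close> leaves a vector killed by all
  functionals, which \<open>sep\<close> puts into \<open>B\<close>.\<close>

lemma basis_of_dual_functionals:
  fixes u :: "'i \<Rightarrow> 'v" and \<kappa> :: "'i \<Rightarrow> 'v \<Rightarrow> 'k"
  assumes fin: "finite I"
    and uZ: "\<And>i. i \<in> I \<Longrightarrow> u i \<in> Z"
    and \<kappa>_add: "\<And>i v w. i \<in> I \<Longrightarrow> v \<in> Z \<Longrightarrow> w \<in> Z \<Longrightarrow> \<kappa> i (v + w) = \<kappa> i v + \<kappa> i w"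
    and \<kappa>_scale: "\<And>i c v. i \<in> I \<Longrightarrow> v \<in> Z \<Longrightarrow> \<kappa> i (c *s v) = c * \<kappa> i v"
    and dual: "\<And>i j. i \<in> I \<Longrightarrow> j \<in> I \<Longrightarrow> \<kappa> i (u j) = (if i = j then 1 else 0)"
    and \<kappa>_B: "\<And>i v. i \<in> I \<Longrightarrow> v \<in> B \<Longrightarrow> \<kappa> i v = 0"
    and sep: "\<And>v. v \<in> Z \<Longrightarrow> (\<And>i. i \<in> I \<Longrightarrow> \<kappa> i v = 0) \<Longrightarrow> v \<in> B"
  shows "vectorspace.basis (class_ring :: 'k ring) Q (cls ` u ` I)"
    and "vectorspace.dim (class_ring :: 'k ring) Q = card I"
    and "inj_on cls (u ` I)"
proof -
  interpret V: vectorspace "class_ring :: 'k ring" Q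
    by (rule Q_vectorspace)
  define comb where "comb a = (\<Sum>j\<in>I. a j *s u j)" for a
  have sum_Z: "(\<Sum>j\<in>J. a j *s u j) \<in> Z" if "J \<subseteq> I" for J a
    using finite_subset[OF that fin] that
    by (induction J rule: finite_induct) (auto intro: Z_zero Z_add Z_scale uZ)
  have \<kappa>_sum: "\<kappa> i (\<Sum>j\<in>J. a j *s u j) = (\<Sum>j\<in>J. a j * \<kappa> i (u j))"
    if "i \<in> I" "J \<subseteq> I" for i J a
    using finite_subset[OF that(2) fin] that
  proof (induction J rule: finite_induct)
    case empty
    then show ?case using \<kappa>_scale[of i 0 0] Z_zero by simp
  next
    case (insert j J)
    then show ?case using \<kappa>_add[of i "a j *s u j" "\<Sum>j\<in>J. a j *s u j"]
      by (simp add: sum_Z Z_scale uZ \<kappa>_scale)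
  qed
  have \<kappa>_comb: "\<kappa> i (comb a) = a i" if "i \<in> I" for i a
  proof -
    have "\<kappa> i (comb a) = (\<Sum>j\<in>I. if i = j then a j else 0)"
      unfolding comb_def \<kappa>_sum[OF that subset_refl] using that dual by (intro sum.cong) auto
    then show ?thesis using that fin by simp
  qed
  have comb_Z: "comb a \<in> Z" for a
    unfolding comb_def by (rule sum_Z) simp
  have inj: "inj_on (\<lambda>i. cls (u i)) I"
  proof (rule inj_onI, rule ccontr)
    fix i j assume ij: "i \<in> I" "j \<in> I" "cls (u i) = cls (u j)" "i \<noteq> j"
    then have "\<kappa> i (u i + (- 1) *s u j) = 0"
      by (intro \<kappa>_B) (simp_all add: cls_eq_iff)
    then show False
      using ij \<kappa>_add[of i "u i" "(- 1) *s u j"] \<kappa>_scale[of i "u j" "- 1"] Z_scale[of "u j" "- 1"] dual uZ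
      by simp
  qed
  \<comment> \<open>\<open>V.lincomb\<close> takes its coefficients on classes; injectivity allows
    reindexing by \<open>I\<close>.\<close>
  have lincomb: "V.lincomb a (cls ` u ` I) = cls (comb (\<lambda>i. a (cls (u i))))" for a
  proof -
    have "V.lincomb a (cls ` u ` I) = finsum Q (\<lambda>v. a v \<odot>\<^bsub>Q\<^esub> v) ((\<lambda>i. cls (u i)) ` I)"
      by (simp add: V.lincomb_def image_image)
    also have "\<dots> = finsum Q (\<lambda>i. a (cls (u i)) \<odot>\<^bsub>Q\<^esub> cls (u i)) I"
      by (rule V.finsum_reindex[OF _ inj]) (use uZ Z_scale in \<open>auto simp: Q_smult Q_carrier\<close>)
    also have "\<dots> = finsum Q (\<lambda>i. cls (a (cls (u i)) *s u i)) I"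
      by (simp add: Q_smult)
    also have "\<dots> = cls (comb (\<lambda>i. a (cls (u i))))"
      unfolding comb_def by (rule Q_finsum) (use fin uZ Z_scale in auto)
    finally show ?thesis .
  qed
  have sub: "cls ` u ` I \<subseteq> carrier Q"
    using uZ by (auto simp: Q_carrier)
  have "V.lin_indpt (cls ` u ` I)"
  proof (rule V.finite_lin_indpt2)
    fix a assume "V.lincomb a (cls ` u ` I) = \<zero>\<^bsub>Q\<^esub>"
    then have "comb (\<lambda>i. a (cls (u i))) \<in> B"
      by (simp add: lincomb Q_zero cls_eq_iff)
    then have "a (cls (u i)) = 0" if "i \<in> I" for i
      using \<kappa>_B[OF that] \<kappa>_comb[OF that, of "\<lambda>i. a (cls (u i))"] by simp
    then show "\<forall>v\<in>cls ` u ` I. a v = \<zero>\<^bsub>class_ring :: 'k ring\<^esub>"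
      by simp
  qed (use fin sub in auto)
  moreover have "V.gen_set (cls ` u ` I)"
  proof
    show "V.span (cls ` u ` I) \<subseteq> carrier Q"
      by (rule V.span_is_subset2[OF sub])
    show "carrier Q \<subseteq> V.span (cls ` u ` I)"
    proof
      fix x assume "x \<in> carrier Q"
      then obtain z where z: "z \<in> Z" "x = cls z"
        by (auto simp: Q_carrier)
      \<comment> \<open>The coefficient of a class is read off at its index, recovered by inverting
        the injection.\<close>
      define a where "a v = \<kappa> (the_inv_into I (\<lambda>i. cls (u i)) v) z" for v
      have a: "comb (\<lambda>i. a (cls (u i))) = comb (\<lambda>i. \<kappa> i z)"
        unfolding comb_def by (intro sum.cong) (simp_all add: a_def the_inv_into_f_f[OF inj])
      have "z + (- 1) *s comb (\<lambda>i. \<kappa> i z) \<in> B"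
      proof (rule sep)
        show "z + (- 1) *s comb (\<lambda>i. \<kappa> i z) \<in> Z"
          by (intro Z_add Z_scale z comb_Z)
        fix i assume i: "i \<in> I"
        show "\<kappa> i (z + (- 1) *s comb (\<lambda>i. \<kappa> i z)) = 0"
          unfolding \<kappa>_add[OF i z(1) Z_scale[OF comb_Z]] \<kappa>_scale[OF i comb_Z] \<kappa>_comb[OF i] by simp
      qed
      then have "x = V.lincomb a (cls ` u ` I)"
        by (simp add: lincomb a z cls_eq_iff)
      then show "x \<in> V.span (cls ` u ` I)"
        unfolding V.span_def using fin by (auto intro!: exI[of _ a] exI[of _ "cls ` u ` I"])
    qed
  qed
  ultimately show basis: "V.basis (cls ` u ` I)"
    using sub by (auto simp: V.basis_def)
  show "V.dim = card I"
    using V.dim_basis[OF _ basis] fin card_image[OF inj] by (simp add: image_image)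
  show "inj_on cls (u ` I)"
    using inj by (auto simp: inj_on_def)
qed

end


section \<open>Coordinates\<close>

lemma gens_iff [simp]:
  "Xg i \<in> gens p \<longleftrightarrow> 1 \<le> i \<and> i \<le> p"
  "Yg i \<in> gens p \<longleftrightarrow> 1 \<le> i \<and> i \<le> p"
  by (auto simp: gens_def)

lemma finite_gens [simp]: "finite (gens p)"
  by (simp add: gens_def)

lemma scl_apply [simp]: "scl c x g = c * x g"
  by (simp add: scl_def)

lemma bvec_apply: "bvec g h = (if h = g then 1 else 0)"
  by (simp add: bvec_def)

lemma sum_fun_apply: "(\<Sum>i\<in>I. f i) x = (\<Sum>i\<in>I. f i x)"
  by (induction I rule: infinite_finite_induct) simp_all

lemma Lpp_closed [simp]:
  "0 \<in> Lpp p" "x \<in> Lpp p \<Longrightarrow> y \<in> Lpp p \<Longrightarrow> x + y \<in> Lpp p"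
  "x \<in> Lpp p \<Longrightarrow> y \<in> Lpp p \<Longrightarrow> x - y \<in> Lpp p"
  "x \<in> Lpp p \<Longrightarrow> - x \<in> Lpp p" "x \<in> Lpp p \<Longrightarrow> scl c x \<in> Lpp p"
  "g \<in> gens p \<Longrightarrow> bvec g \<in> Lpp p" "x \<in> Lpp p \<Longrightarrow> hcomp a x \<in> Lpp p"
  by (auto simp: Lpp_def bvec_def hcomp_def)

lemma Lhom_closed [simp]:
  "0 \<in> Lhom p a" "x \<in> Lhom p a \<Longrightarrow> y \<in> Lhom p a \<Longrightarrow> x + y \<in> Lhom p a"
  "x \<in> Lhom p a \<Longrightarrow> y \<in> Lhom p a \<Longrightarrow> x - y \<in> Lhom p a"
  "x \<in> Lhom p a \<Longrightarrow> scl c x \<in> Lhom p a"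
  "x \<in> Lpp p \<Longrightarrow> hcomp a x \<in> Lhom p a"
  by (auto simp: Lhom_def hcomp_def Lpp_def)

lemma bvec_Lhom [simp]: "bvec g \<in> Lhom p a \<longleftrightarrow> g \<in> gens p \<and> parity g = a"
  by (auto simp: Lhom_def bvec_def Lpp_def split: if_splits)

lemma Lhom_Lpp [simp]: "x \<in> Lhom p a \<Longrightarrow> x \<in> Lpp p"
  by (simp add: Lhom_def)

lemma Lhom_nonzero: "x \<in> Lhom p a \<Longrightarrow> x g \<noteq> 0 \<Longrightarrow> g \<in> gens p \<and> parity g = a"
  by (auto simp: Lhom_def Lpp_def)

lemma hcomp_split: "x = hcomp 0 x + hcomp 1 x"
proof
  fix g show "x g = (hcomp 0 x + hcomp 1 x) g"
    by (cases g) (auto simp: hcomp_def)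
qed

lemma Lpp_eqI: "x \<in> Lpp p \<Longrightarrow> y \<in> Lpp p \<Longrightarrow> (\<And>g. g \<in> gens p \<Longrightarrow> x g = y g) \<Longrightarrow> x = y"
  by (rule ext) (metis (mono_tags, lifting) Lpp_def mem_Collect_eq)


section \<open>Linear and bilinear forms\<close>

lemma linear_on_LD:
  assumes "linear_on_L p f"
  shows "x \<in> Lpp p \<Longrightarrow> y \<in> Lpp p \<Longrightarrow> f (x + y) = f x + f y"
    and "x \<in> Lpp p \<Longrightarrow> f (scl c x) = c * f x"
    and "f 0 = 0"
    and "x \<in> Lpp p \<Longrightarrow> f (- x) = - f x"
    and "x \<in> Lpp p \<Longrightarrow> y \<in> Lpp p \<Longrightarrow> f (x - y) = f x - f y"
proof -
  show add: "f (x + y) = f x + f y" if "x \<in> Lpp p" "y \<in> Lpp p" for x y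
    using assms that by (simp add: linear_on_L_def)
  show scl: "f (scl c x) = c * f x" if "x \<in> Lpp p" for c x
    using assms that by (simp add: linear_on_L_def)
  have "scl 0 0 = (0 :: 'a elt)"
    by (simp add: fun_eq_iff)
  then show "f 0 = 0"
    using scl[of 0 0] by simp
  have "scl (- 1) x = - x" for x :: "'a elt"
    by (simp add: fun_eq_iff)
  then show minus: "f (- x) = - f x" if "x \<in> Lpp p" for x
    using scl[OF that, of "- 1"] by simp
  show "f (x - y) = f x - f y" if "x \<in> Lpp p" "y \<in> Lpp p" for x y
    using add[of x "- y"] minus[of y] that by simp
qed

lemma linear_on_L_expand:
  assumes f: "linear_on_L p f" and x: "x \<in> Lpp p"
  shows "f x = (\<Sum>g\<in>gens p. x g * f (bvec g))"
proof -
  \<comment> \<open>\<open>f\<close> is additive on \<open>Lpp p\<close> only, so the induction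
    carries membership of the partial sums along.\<close>
  have *: "(\<Sum>g\<in>G. scl (x g) (bvec g)) \<in> Lpp p \<and>
      f (\<Sum>g\<in>G. scl (x g) (bvec g)) = (\<Sum>g\<in>G. x g * f (bvec g))" if "G \<subseteq> gens p" for G
    using finite_subset[OF that finite_gens] that
    by (induction G rule: finite_induct) (simp_all add: linear_on_LD[OF f])
  have "x = (\<Sum>g\<in>gens p. scl (x g) (bvec g))"
  proof (rule Lpp_eqI[OF x])
    fix h assume "h \<in> gens p"
    have "(\<Sum>g\<in>gens p. scl (x g) (bvec g)) h = (\<Sum>g\<in>gens p. if g = h then x h else 0)"
      unfolding sum_fun_apply by (rule sum.cong) (auto simp: bvec_def)
    then show "x h = (\<Sum>g\<in>gens p. scl (x g) (bvec g)) h"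
      using \<open>h \<in> gens p\<close> by simp
  qed (use * in auto)
  then show ?thesis
    using * by (metis order_refl)
qed

lemma linear_on_L_sum: "linear_on_L p (\<lambda>x. \<Sum>g\<in>gens p. x g * c g)"
  by (auto simp: linear_on_L_def sum.distrib sum_distrib_left algebra_simps)

text \<open>Comparing forms on pairs of basis vectors uses bilinearity alone; isolating it from
  \<open>C2\<close> makes the comparison available for \<open>leibniz p f\<close> without a proof of
  skew-symmetry.\<close>

definition bilinear_on_L :: "nat \<Rightarrow> 'a::field form2 \<Rightarrow> bool" where
  "bilinear_on_L p f \<longleftrightarrow>
     (\<forall>y\<in>Lpp p. linear_on_L p (\<lambda>x. f x y)) \<and> (\<forall>x\<in>Lpp p. linear_on_L p (f x))"

lemma bilinear_on_LD:
  assumes "bilinear_on_L p f"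
  shows "y \<in> Lpp p \<Longrightarrow> linear_on_L p (\<lambda>x. f x y)"
    and "x \<in> Lpp p \<Longrightarrow> linear_on_L p (f x)"
  using assms by (auto simp: bilinear_on_L_def)

lemma bilinear_on_L_expand:
  assumes f: "bilinear_on_L p f" and "x \<in> Lpp p" "y \<in> Lpp p"
  shows "f x y = (\<Sum>g\<in>gens p. \<Sum>h\<in>gens p. x g * y h * f (bvec g) (bvec h))"
proof -
  have "f x y = (\<Sum>g\<in>gens p. x g * f (bvec g) y)"
    by (rule linear_on_L_expand[OF bilinear_on_LD(1)[OF f]]) fact+
  also have "\<dots> = (\<Sum>g\<in>gens p. x g * (\<Sum>h\<in>gens p. y h * f (bvec g) (bvec h)))"
    using assms by (intro sum.cong refl arg_cong2[where f = "(*)"] linear_on_L_expand bilinear_on_LD) auto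
  finally show ?thesis
    by (simp add: sum_distrib_left mult.assoc)
qed

lemma bilinear_on_L_eq:
  assumes "bilinear_on_L p f" "bilinear_on_L p f'" "x \<in> Lpp p" "y \<in> Lpp p"
    and "\<And>g h. g \<in> gens p \<Longrightarrow> h \<in> gens p \<Longrightarrow> f (bvec g) (bvec h) = f' (bvec g) (bvec h)"
  shows "f x y = f' x y"
  unfolding bilinear_on_L_expand[OF assms(1,3,4)] bilinear_on_L_expand[OF assms(2,3,4)]
  using assms(5) by simp

section \<open>The space of 2-cochains\<close>

lemma C2_bilinear: "f \<in> C2 p \<Longrightarrow> bilinear_on_L p f"
  by (simp add: C2_def bilinear_on_L_def)

lemma C2_skew:
  "f \<in> C2 p \<Longrightarrow> x \<in> Lhom p a \<Longrightarrow> y \<in> Lhom p b \<Longrightarrow> a \<in> {0,1} \<Longrightarrow> b \<in> {0,1} \<Longrightarrow>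
     f x y = - ((-1) ^ (a * b) * f y x)"
  unfolding C2_def mem_Collect_eq eq_neg_iff_add_eq_0 by blast

lemma C2_outside: "f \<in> C2 p \<Longrightarrow> x \<notin> Lpp p \<or> y \<notin> Lpp p \<Longrightarrow> f x y = 0"
  by (simp add: C2_def)

lemmas C2_linear_left = linear_on_LD[OF bilinear_on_LD(1)[OF C2_bilinear]]
lemmas C2_linear_right = linear_on_LD[OF bilinear_on_LD(2)[OF C2_bilinear]]

lemma C2_eqI:
  assumes "f \<in> C2 p" "f' \<in> C2 p"
    and "\<And>g h. g \<in> gens p \<Longrightarrow> h \<in> gens p \<Longrightarrow> f (bvec g) (bvec h) = f' (bvec g) (bvec h)"
  shows "f = f'"
proof (intro ext)
  fix x y
  show "f x y = f' x y"
    using assms bilinear_on_L_eq[of p f f' x y] C2_outside[of f p x y] C2_outside[of f' p x y]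
    by (cases "x \<in> Lpp p \<and> y \<in> Lpp p") (auto simp: C2_bilinear)
qed

lemma form_of_bvec:
  assumes "g \<in> gens p" "h \<in> gens p"
  shows "form_of p m (bvec g) (bvec h) = m g h"
proof -
  have "form_of p m (bvec g) (bvec h) = (\<Sum>g'\<in>gens p. \<Sum>h'\<in>gens p. bvec g g' * bvec h h' * m g' h')"
    using assms by (simp add: form_of_def)
  also have "\<dots> =
      (\<Sum>g'\<in>gens p. \<Sum>h'\<in>gens p. if h' = h then (if g' = g then m g h else 0) else 0)"
    by (intro sum.cong refl) (simp add: bvec_def)
  also have "\<dots> = m g h"
    using assms by simp
  finally show ?thesis .
qed

lemma form_of_bilinear: "bilinear_on_L p (form_of p m)"
  unfolding bilinear_on_L_def linear_on_L_def form_of_def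
  by (auto simp: sum.distrib sum_distrib_left algebra_simps)

text \<open>Only generators of parities \<open>a\<close> and \<open>b\<close> contribute to
  homogeneous arguments, so the sign rule for generators is the sign rule for the arguments.\<close>

lemma form_of_C2:
  assumes m: "\<And>g h. g \<in> gens p \<Longrightarrow> h \<in> gens p \<Longrightarrow> m g h = - ((-1) ^ (parity g * parity h) * m h g)"
  shows "form_of p m \<in> C2 p"
proof -
  have "form_of p m x y + (-1) ^ (a * b) * form_of p m y x = 0"
    if "x \<in> Lhom p a" "y \<in> Lhom p b" for x y a b
  proof -
    have "form_of p m y x = (\<Sum>g\<in>gens p. \<Sum>h\<in>gens p. y h * x g * m h g)"
      using that by (simp add: form_of_def) (rule sum.swap)
    then have "form_of p m x y + (-1) ^ (a * b) * form_of p m y x =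
        (\<Sum>g\<in>gens p. \<Sum>h\<in>gens p. x g * y h * (m g h + (-1) ^ (a * b) * m h g))"
      using that by (simp add: form_of_def sum.distrib sum_distrib_left algebra_simps)
    also have "\<dots> = 0"
    proof (intro sum.neutral ballI)
      fix g h assume "g \<in> gens p" "h \<in> gens p"
      then show "x g * y h * (m g h + (-1) ^ (a * b) * m h g) = 0"
        using Lhom_nonzero[OF that(1), of g] Lhom_nonzero[OF that(2), of h] m[of g h]
        by (cases "x g = 0 \<or> y h = 0") auto
    qed
    finally show ?thesis .
  qed
  moreover have "form_of p m x y = 0" if "x \<notin> Lpp p \<or> y \<notin> Lpp p" for x y
    using that by (auto simp: form_of_def)
  ultimately show ?thesis
    using form_of_bilinear[of p m] unfolding C2_def bilinear_on_L_def by blast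
qed

lemma C2_zero: "0 \<in> C2 p"
  by (simp add: C2_def linear_on_L_def)

lemma C2_add: "f \<in> C2 p \<Longrightarrow> f' \<in> C2 p \<Longrightarrow> f + f' \<in> C2 p"
proof -
  assume "f \<in> C2 p" "f' \<in> C2 p"
  then show ?thesis
    unfolding C2_def mem_Collect_eq linear_on_L_def plus_fun_apply distrib_left
    by (simp add: add_ac)
qed

lemma C2_scale: "f \<in> C2 p \<Longrightarrow> (\<lambda>x y. c * f x y) \<in> C2 p"
  unfolding C2_def mem_Collect_eq linear_on_L_def
  by (simp add: algebra_simps) (metis (no_types, lifting) distrib_left mult_zero_right)


section \<open>The bracket\<close>

text \<open>The derivation ad X_1 as a shift of coordinates. It kills X_1, and X_2 and Y_1 are not
  in its image; this explains the lower bounds 3 and 2.\<close>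

definition adX1 :: "nat \<Rightarrow> 'a::field elt \<Rightarrow> 'a elt" where
  "adX1 p x = (\<lambda>g. case g of
      Xg i \<Rightarrow> if 3 \<le> i \<and> i \<le> p then x (Xg (i - 1)) else 0
    | Yg j \<Rightarrow> if 2 \<le> j \<and> j \<le> p then x (Yg (j - 1)) else 0)"

lemma adX1_apply [simp]:
  "adX1 p x (Xg i) = (if 3 \<le> i \<and> i \<le> p then x (Xg (i - 1)) else 0)"
  "adX1 p x (Yg j) = (if 2 \<le> j \<and> j \<le> p then x (Yg (j - 1)) else 0)"
  by (simp_all add: adX1_def)

lemma gen_fun_eqI: "(\<And>i. x (Xg i) = y (Xg i)) \<Longrightarrow> (\<And>i. x (Yg i) = y (Yg i)) \<Longrightarrow> x = y"
  by (rule ext) (metis gen.exhaust)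

lemma adX1_linear:
  "adX1 p (x + y) = adX1 p x + adX1 p y" "adX1 p (scl c x) = scl c (adX1 p x)"
  "adX1 p 0 = 0"
  by (rule gen_fun_eqI; simp)+

lemma adX1_Lpp [simp]: "adX1 p x \<in> Lpp p"
proof -
  have "adX1 p x g = 0" if "g \<notin> gens p" for g
    using that by (cases g) auto
  then show ?thesis by (simp add: Lpp_def)
qed

lemma adX1_Lhom [simp]: "x \<in> Lhom p a \<Longrightarrow> adX1 p x \<in> Lhom p a"
proof -
  assume x: "x \<in> Lhom p a"
  have x0: "x g = 0" if "parity g \<noteq> a" for g
    using Lhom_nonzero[OF x, of g] that by blast
  have "adX1 p x g = 0" if "parity g \<noteq> a" for g
    using that by (cases g) (simp_all add: x0)
  then show ?thesis
    unfolding Lhom_def by simp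
qed

lemma adX1_bvec:
  assumes "p > 2" "1 \<le> i" "i \<le> p"
  shows "adX1 p (bvec (Xg i)) = (if 2 \<le> i \<and> i \<le> p - 1 then bvec (Xg (i + 1)) else 0)"
    and "adX1 p (bvec (Yg i)) = (if i \<le> p - 1 then bvec (Yg (i + 1)) else 0)"
  using assms by (auto intro!: gen_fun_eqI simp: bvec_def)

lemma sum_bvec:
  assumes "h \<in> gens p"
  shows "(\<Sum>g\<in>gens p. x g * bvec g h) = x h"
proof -
  have "(\<Sum>g\<in>gens p. x g * bvec g h) = (\<Sum>g\<in>gens p. if g = h then x h else 0)"
    by (rule sum.cong) (auto simp: bvec_def)
  then show ?thesis using assms by simp
qed

lemma adX1_expand: "adX1 p x k = (\<Sum>g\<in>gens p. x g * adX1 p (bvec g) k)"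
proof (cases k)
  case (Xg i)
  have "(\<Sum>g\<in>gens p. x g * bvec g (Xg (i - 1))) = x (Xg (i - 1))" if "3 \<le> i" "i \<le> p"
    by (rule sum_bvec) (use that in auto)
  then show ?thesis
    using Xg by auto
next
  case (Yg i)
  have "(\<Sum>g\<in>gens p. x g * bvec g (Yg (i - 1))) = x (Yg (i - 1))" if "2 \<le> i" "i \<le> p"
    by (rule sum_bvec) (use that in auto)
  then show ?thesis
    using Yg by auto
qed

text \<open>At \<open>g = h = Xg 1\<close> both terms are present, but each is 0 since ad X_1 kills
  X_1; hence one formula covers all cases.\<close>

lemma gbr_eq:
  assumes "p > 2" "g \<in> gens p" "h \<in> gens p"
  shows "gbr p g h = (if g = Xg 1 then adX1 p (bvec h) else 0) - (if h = Xg 1 then adX1 p (bvec g) else 0)"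
  using assms by (cases g; cases h) (auto simp: adX1_bvec)

lemma br_eq:
  assumes "p > 2"
  shows "br p x y = scl (x (Xg 1)) (adX1 p y) - scl (y (Xg 1)) (adX1 p x)"
proof
  fix k
  have "br p x y k = (\<Sum>g\<in>gens p. \<Sum>h\<in>gens p. x g * y h * gbr p g h k)"
    by (simp add: br_def sum_fun_apply)
  also have "\<dots> = (\<Sum>g\<in>gens p. \<Sum>h\<in>gens p. (if g = Xg 1 then x (Xg 1) * (y h * adX1 p (bvec h) k) else 0)
        - (if h = Xg 1 then y (Xg 1) * (x g * adX1 p (bvec g) k) else 0))"
    by (intro sum.cong refl) (auto simp: gbr_eq[OF assms] algebra_simps)
  \<comment> \<open>Swapping the first double sum puts each Kronecker delta innermost, where it
    collapses.\<close>
  also have "\<dots> = (\<Sum>h\<in>gens p. \<Sum>g\<in>gens p. if g = Xg 1 then x (Xg 1) * (y h * adX1 p (bvec h) k) else 0)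
        - (\<Sum>g\<in>gens p. \<Sum>h\<in>gens p. if h = Xg 1 then y (Xg 1) * (x g * adX1 p (bvec g) k) else 0)"
    unfolding sum_subtractf by (rule arg_cong2[where f = "(-)", OF sum.swap refl])
  also have "\<dots> = x (Xg 1) * (\<Sum>h\<in>gens p. y h * adX1 p (bvec h) k)
        - y (Xg 1) * (\<Sum>g\<in>gens p. x g * adX1 p (bvec g) k)"
    using assms by (simp add: sum_distrib_left)
  also have "\<dots> = (scl (x (Xg 1)) (adX1 p y) - scl (y (Xg 1)) (adX1 p x)) k"
    by (simp add: adX1_expand[symmetric])
  finally show "br p x y k = (scl (x (Xg 1)) (adX1 p y) - scl (y (Xg 1)) (adX1 p x)) k" .
qed


section \<open>Ordinary cocycles\<close>

text \<open>The defect of invariance of \<open>f\<close> under ad X_1, that is, its Lie derivative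
  along X_1 up to sign.\<close>

definition leibniz :: "nat \<Rightarrow> 'a::field form2 \<Rightarrow> 'a form2" where
  "leibniz p f x y = f (adX1 p x) y + f x (adX1 p y)"

lemma leibniz_bilinear:
  assumes "f \<in> C2 p"
  shows "bilinear_on_L p (leibniz p f)"
  unfolding bilinear_on_L_def linear_on_L_def leibniz_def
  using C2_linear_left[OF assms] C2_linear_right[OF assms]
  by (auto simp: adX1_linear algebra_simps)

text \<open>X_1 is even: an argument with nonzero X_1-coefficient has parity 0, so the signs in
  which it takes part disappear. The remaining signs are absorbed by skew-symmetry, and the
  resulting formula is free of parities.\<close>

lemma d2_hom_eq:
  assumes p: "p > 2" and f: "f \<in> C2 p"
    and hom: "x \<in> Lhom p a" "y \<in> Lhom p b" "z \<in> Lhom p c"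
    and par: "a \<in> {0,1}" "b \<in> {0,1}" "c \<in> {0,1}"
  shows "d2_hom p f a b c x y z =
    y (Xg 1) * leibniz p f x z - x (Xg 1) * leibniz p f y z - z (Xg 1) * leibniz p f x y"
proof -
  have odd: "x (Xg 1) = 0 \<or> a = 0" "y (Xg 1) = 0 \<or> b = 0" "z (Xg 1) = 0 \<or> c = 0"
    using hom[THEN Lhom_nonzero, of "Xg 1"] by auto
  have L: "x \<in> Lpp p" "y \<in> Lpp p" "z \<in> Lpp p"
    using hom by auto
  have br: "f (br p u v) w = u (Xg 1) * f (adX1 p v) w - v (Xg 1) * f (adX1 p u) w"
    if "w \<in> Lpp p" for u v w
    using that by (simp add: br_eq[OF p] C2_linear_left[OF f])
  have zy: "f (adX1 p z) y = - ((-1) ^ (c * b) * f y (adX1 p z))"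
    by (rule C2_skew[OF f]) (use hom par in auto)
  have zx: "f (adX1 p z) x = - ((-1) ^ (c * a) * f x (adX1 p z))"
    by (rule C2_skew[OF f]) (use hom par in auto)
  have yx: "f (adX1 p y) x = - ((-1) ^ (b * a) * f x (adX1 p y))"
    by (rule C2_skew[OF f]) (use hom par in auto)
  show ?thesis
    unfolding d2_hom_def br[OF L(1)] br[OF L(2)] br[OF L(3)] zy zx yx leibniz_def
    using par odd by (auto simp: algebra_simps)
qed

text \<open>The X_1-coefficient of an element sits entirely in its even part. In each of the three
  terms one of the parity sums thus has a single summand, and the other two reassemble
  \<open>leibniz p f\<close> by bilinearity.\<close>

lemma d2_eq:
  assumes p: "p > 2" and f: "f \<in> C2 p" and L: "x \<in> Lpp p" "y \<in> Lpp p" "z \<in> Lpp p"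
  shows "d2 p f x y z =
    y (Xg 1) * leibniz p f x z - x (Xg 1) * leibniz p f y z - z (Xg 1) * leibniz p f x y"
proof -
  have hX: "hcomp 0 u (Xg 1) = u (Xg 1)" "hcomp 1 u (Xg 1) = 0" for u :: "'a elt"
    by (simp_all add: hcomp_def)
  have split: "leibniz p f u v = leibniz p f (hcomp 0 u) (hcomp 0 v) + leibniz p f (hcomp 0 u) (hcomp 1 v)
      + leibniz p f (hcomp 1 u) (hcomp 0 v) + leibniz p f (hcomp 1 u) (hcomp 1 v)"
    if "u \<in> Lpp p" "v \<in> Lpp p" for u v
  proof -
    have "leibniz p f u v = leibniz p f (hcomp 0 u + hcomp 1 u) (hcomp 0 v + hcomp 1 v)"
      using hcomp_split[of u] hcomp_split[of v] by simp
    then show ?thesis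
      using that linear_on_LD(1)[OF bilinear_on_LD(1)[OF leibniz_bilinear[OF f]]]
        linear_on_LD(1)[OF bilinear_on_LD(2)[OF leibniz_bilinear[OF f]]]
      by (simp add: add_ac del: One_nat_def)
  qed
  have hom: "d2_hom p f a b c (hcomp a x) (hcomp b y) (hcomp c z) =
      hcomp b y (Xg 1) * leibniz p f (hcomp a x) (hcomp c z)
      - hcomp a x (Xg 1) * leibniz p f (hcomp b y) (hcomp c z)
      - hcomp c z (Xg 1) * leibniz p f (hcomp a x) (hcomp b y)"
    if "a \<in> {0,1}" "b \<in> {0,1}" "c \<in> {0,1}" for a b c
    by (rule d2_hom_eq[OF p f]) (use L that in auto)
  have "d2 p f x y z = (\<Sum>a\<in>{0,1}. \<Sum>b\<in>{0,1}. \<Sum>c\<in>{0,1}.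
      hcomp b y (Xg 1) * leibniz p f (hcomp a x) (hcomp c z)
      - hcomp a x (Xg 1) * leibniz p f (hcomp b y) (hcomp c z)
      - hcomp c z (Xg 1) * leibniz p f (hcomp a x) (hcomp b y))"
    unfolding d2_def using L by (simp only: if_True simp_thms) (intro sum.cong refl hom)
  also have "\<dots> = y (Xg 1) * leibniz p f x z - x (Xg 1) * leibniz p f y z - z (Xg 1) * leibniz p f x y"
    unfolding split[OF L(1,2)] split[OF L(1,3)] split[OF L(2,3)]
    by (simp add: hX del: One_nat_def) (simp add: algebra_simps)
  finally show ?thesis .
qed

text \<open>X_1 is left out because the defect on a pair (X_1, h) is f(X_1, D h), which the cocycle
  condition does not restrict.\<close>

definition adX1_invariant :: "nat \<Rightarrow> 'a::field form2 \<Rightarrow> bool" where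
  "adX1_invariant p f \<longleftrightarrow>
     (\<forall>g\<in>gens p - {Xg 1}. \<forall>h\<in>gens p - {Xg 1}. leibniz p f (bvec g) (bvec h) = 0)"

lemma adX1_X1 [simp]: "adX1 p (bvec (Xg 1)) = 0" "adX1 p (bvec (Xg (Suc 0))) = 0"
  by (auto intro!: gen_fun_eqI simp: bvec_def)

lemma leibniz_invariant:
  assumes p: "p > 2" and f: "f \<in> C2 p" and inv: "adX1_invariant p f" and L: "x \<in> Lpp p" "y \<in> Lpp p"
  shows "leibniz p f x y =
    x (Xg 1) * f (bvec (Xg 1)) (adX1 p y) - y (Xg 1) * f (bvec (Xg 1)) (adX1 p x)"
proof (rule bilinear_on_L_eq[OF leibniz_bilinear[OF f] _ L])
  have X1: "bvec (Xg 1) \<in> Lpp p" "bvec (Xg 1) \<in> Lhom p 0"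
    using p by simp_all
  show "bilinear_on_L p (\<lambda>x y. x (Xg 1) * f (bvec (Xg 1)) (adX1 p y) - y (Xg 1) * f (bvec (Xg 1)) (adX1 p x))"
    unfolding bilinear_on_L_def linear_on_L_def
    using C2_linear_right(1,2)[OF f X1(1)] by (auto simp: adX1_linear algebra_simps)
  fix g h assume gh: "g \<in> gens p" "h \<in> gens p"
  \<comment> \<open>Since X_1 is even, the swap costs a plain minus sign for either parity of
    \<open>g\<close>.\<close>
  have "f (adX1 p (bvec g)) (bvec (Xg 1)) = - f (bvec (Xg 1)) (adX1 p (bvec g))"
  proof -
    have "parity g \<in> {0, 1}"
      by (cases g) auto
    then show ?thesis
      using C2_skew[OF f adX1_Lhom X1(2), of "bvec g" "parity g"] gh by auto
  qed
  then show "leibniz p f (bvec g) (bvec h) = bvec g (Xg 1) * f (bvec (Xg 1)) (adX1 p (bvec h))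
      - bvec h (Xg 1) * f (bvec (Xg 1)) (adX1 p (bvec g))"
    using gh X1 inv C2_linear_left(3)[OF f] C2_linear_right(3)[OF f]
    unfolding adX1_invariant_def by (cases "g = Xg 1"; cases "h = Xg 1") (auto simp: leibniz_def bvec_apply)
qed

text \<open>Inserting X_1 as first argument isolates the defect on the other two. Conversely, the
  formula of \<open>leibniz_invariant\<close> turns \<open>d2_eq\<close> into six terms that cancel
  in pairs.\<close>

lemma d2_eq_0_iff:
  assumes p: "p > 2" and f: "f \<in> C2 p"
  shows "d2 p f = 0 \<longleftrightarrow> adX1_invariant p f"
proof
  assume d2: "d2 p f = 0"
  show "adX1_invariant p f"
    unfolding adX1_invariant_def
  proof (intro ballI)
    fix g h assume "g \<in> gens p - {Xg 1}" "h \<in> gens p - {Xg 1}"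
    then show "leibniz p f (bvec g) (bvec h) = 0"
      using d2_eq[OF p f, of "bvec (Xg 1)" "bvec g" "bvec h"] d2 p by (auto simp: bvec_apply)
  qed
next
  assume "adX1_invariant p f"
  note leibniz = leibniz_invariant[OF p f this]
  have "d2 p f x y z = 0" for x y z
  proof (cases "x \<in> Lpp p \<and> y \<in> Lpp p \<and> z \<in> Lpp p")
    case True
    then show ?thesis
      by (simp add: d2_eq[OF p f] leibniz algebra_simps)
  qed (simp only: d2_def if_False)
  then show "d2 p f = 0"
    by (simp add: fun_eq_iff)
qed


section \<open>The restricted structure\<close>

lemma lbr_snoc: "xs \<noteq> [] \<Longrightarrow> lbr p (xs @ [y]) = br p (lbr p xs) y"
  by (cases xs) (simp_all add: lbr_def)

lemma br_Lev:
  assumes "p > 2" "x \<in> Lev p" "y \<in> Lev p"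
  shows "br p x y \<in> Lev p"
  using assms by (simp add: br_eq)

text \<open>Even elements of the \<open>n\<close>-th term of the descending central series, \<open>n \<ge> 2\<close>, only involve
  \<open>X\<^sub>i\<close> with \<open>i > n\<close>.\<close>

lemma lbr_deep:
  assumes p: "p > 2"
  shows "set xs \<subseteq> Lev p \<Longrightarrow> 2 \<le> length xs \<Longrightarrow>
    lbr p xs \<in> Lev p \<and> (\<forall>i\<le>length xs. lbr p xs (Xg i) = 0)"
proof (induction xs rule: rev_induct)
  case (snoc y xs)
  show ?case
  proof (cases "length xs = 1")
    \<comment> \<open>The first bracket already removes both X_1 and X_2, since X_2 is not in the
      image of ad X_1; every later bracket removes one more index.\<close>
    case True
    then obtain x where "xs = [x]"
      by (cases xs) auto
    then show ?thesis
      using snoc.prems p by (simp add: lbr_def br_Lev) (simp add: br_eq)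
  next
    case False
    then have len: "2 \<le> length xs" "xs \<noteq> []"
      using snoc.prems by auto
    with snoc have IH: "lbr p xs \<in> Lev p" "\<And>i. i \<le> length xs \<Longrightarrow> lbr p xs (Xg i) = 0"
      by auto
    \<comment> \<open>Without an X_1-coefficient in the left factor, the next bracket is a multiple
      of ad X_1 applied to it, which shifts the support by one.\<close>
    have "lbr p xs (Xg 1) = 0"
      using len by (intro IH) auto
    moreover have "adX1 p (lbr p xs) (Xg i) = 0" if "i \<le> Suc (length xs)" for i
      using IH(2)[of "i - 1"] that by auto
    ultimately show ?thesis
      using IH(1) snoc.prems p len by (simp add: lbr_snoc br_Lev) (simp add: br_eq)
  qed
qed simp

lemma Lev_zero: "x \<in> Lev p \<Longrightarrow> (\<And>i. 1 \<le> i \<Longrightarrow> i \<le> p \<Longrightarrow> x (Xg i) = 0) \<Longrightarrow> x = 0"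
proof (rule gen_fun_eqI)
  fix i assume "x \<in> Lev p" "\<And>i. 1 \<le> i \<Longrightarrow> i \<le> p \<Longrightarrow> x (Xg i) = 0"
  then show "x (Xg i) = 0 (Xg i)" "x (Yg i) = 0 (Yg i)"
    using Lhom_nonzero[of x p 0 "Xg i"] Lhom_nonzero[of x p 0 "Yg i"] by auto
qed

text \<open>At depth \<open>p\<close> no index is left. This removes the iterated bracket from
  \<open>ind2\<close>.\<close>

lemma lbr_long:
  assumes "p > 2" "set xs \<subseteq> Lev p" "length xs = p"
  shows "lbr p xs = 0"
  using lbr_deep[OF assms(1,2)] assms by (intro Lev_zero[of _ p]) auto

lemma lbr_top:
  assumes "p > 2" "set xs \<subseteq> Lev p" "length xs = p - 1"
  obtains c where "lbr p xs = scl c (bvec (Xg p))"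
proof -
  have deep: "lbr p xs \<in> Lev p" "\<And>i. i \<le> p - 1 \<Longrightarrow> lbr p xs (Xg i) = 0"
    using lbr_deep[OF assms(1,2)] assms by auto
  have "lbr p xs - scl (lbr p xs (Xg p)) (bvec (Xg p)) = 0"
  proof (rule Lev_zero)
    show "lbr p xs - scl (lbr p xs (Xg p)) (bvec (Xg p)) \<in> Lev p"
      using deep assms by simp
    fix i assume "1 \<le> i" "i \<le> p"
    then show "(lbr p xs - scl (lbr p xs (Xg p)) (bvec (Xg p))) (Xg i) = 0"
      using deep(2)[of i] by (cases "i = p") (auto simp: bvec_apply)
  qed
  then show ?thesis
    using that by simp
qed

text \<open>All values of the p-map are multiples of X_p, so for nonzero \<lambda> this is what the
  vanishing of \<open>ind2\<close> amounts to.\<close>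

definition kills_Xp :: "nat \<Rightarrow> 'a::field form2 \<Rightarrow> bool" where
  "kills_Xp p f \<longleftrightarrow> (\<forall>i\<in>{1..p}. f (bvec (Xg i)) (bvec (Xg p)) = 0)"

lemma kills_XpD:
  assumes p: "p > 2" and f: "f \<in> C2 p" "kills_Xp p f" and x: "x \<in> Lev p"
  shows "f x (bvec (Xg p)) = 0" and "f (bvec (Xg p)) x = 0"
proof -
  have Xp: "bvec (Xg p) \<in> Lev p" "bvec (Xg p) \<in> Lpp p"
    using p by auto
  have "x g * f (bvec g) (bvec (Xg p)) = 0" if "g \<in> gens p" for g
    using f(2) that Lhom_nonzero[OF x, of g] by (cases g) (auto simp: kills_Xp_def)
  then show *: "f x (bvec (Xg p)) = 0"
    using linear_on_L_expand[OF bilinear_on_LD(1)[OF C2_bilinear[OF f(1)] Xp(2)], of x] x by simp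
  show "f (bvec (Xg p)) x = 0"
    using C2_skew[OF f(1) Xp(1) x] * by simp
qed

lemma star_sum_eq_0:
  assumes p: "p > 2" and f: "f \<in> C2 p" "kills_Xp p f" and xy: "x \<in> Lev p" "y \<in> Lev p"
  shows "star_sum p f x y = 0"
  unfolding star_sum_def
proof (intro sum.neutral ballI)
  fix bs assume "bs \<in> choices p"
  then have len: "length bs = p"
    by (simp add: choices_def)
  define xs where "xs = map (\<lambda>b. if b then x else y) bs"
  have xs: "set xs \<subseteq> Lev p" "length xs = p" "xs \<noteq> []"
    using len p xy by (auto simp: xs_def)
  then have "set (butlast xs) \<subseteq> Lev p" "length (butlast xs) = p - 1" "last xs \<in> Lev p"
    using last_in_set[OF xs(3)] by (auto dest!: in_set_butlastD)
  moreover from lbr_top[OF p this(1,2)] obtain c where "lbr p (butlast xs) = scl c (bvec (Xg p))" .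
  ultimately have "f (lbr p (butlast xs)) (last xs) = 0"
    using p kills_XpD(2)[OF p f] by (simp add: C2_linear_left[OF f(1)])
  then show "(let xs = map (\<lambda>b. if b then x else y) bs in
      1 / of_nat (count_list bs True) * f (lbr p (butlast xs)) (last xs)) = 0"
    by (simp add: Let_def xs_def)
qed

section \<open>Frobenius-semilinear maps and the star-property\<close>

definition p_semilinear :: "nat \<Rightarrow> 'a::field form1 \<Rightarrow> bool" where
  "p_semilinear p w \<longleftrightarrow>
     (\<forall>c. \<forall>x\<in>Lev p. w (scl c x) = c ^ p * w x) \<and> (\<forall>x\<in>Lev p. \<forall>y\<in>Lev p. w (x + y) = w x + w y)"

lemma star_property_iff:
  assumes "p > 2" "f \<in> C2 p" "kills_Xp p f"
  shows "star_property p f w \<longleftrightarrow> p_semilinear p w"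
  using star_sum_eq_0[OF assms] by (simp add: star_property_def p_semilinear_def)

lemma p_semilinear_expand:
  assumes w: "p_semilinear p w" and x: "x \<in> Lev p"
  shows "w x = (\<Sum>i\<in>{1..p}. x (Xg i) ^ p * w (bvec (Xg i)))"
proof -
  have w_add: "w (x + y) = w x + w y" if "x \<in> Lev p" "y \<in> Lev p" for x y
    using w that by (simp add: p_semilinear_def)
  have w_scl: "w (scl c x) = c ^ p * w x" if "x \<in> Lev p" for c x
    using w that by (simp add: p_semilinear_def)
  have "w 0 = 0"
    by (metis Lhom_closed(1) add_0 add_cancel_right_right w_add)
  have *: "(\<Sum>i\<in>I. scl (x (Xg i)) (bvec (Xg i))) \<in> Lev p \<and>
      w (\<Sum>i\<in>I. scl (x (Xg i)) (bvec (Xg i))) = (\<Sum>i\<in>I. x (Xg i) ^ p * w (bvec (Xg i)))"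
    if "I \<subseteq> {1..p}" for I
    using finite_subset[OF that finite_atLeastAtMost] that
  proof (induction I rule: finite_induct)
    case (insert i I)
    let ?s = "\<Sum>i\<in>I. scl (x (Xg i)) (bvec (Xg i))"
    have IH: "?s \<in> Lev p" "w ?s = (\<Sum>i\<in>I. x (Xg i) ^ p * w (bvec (Xg i)))"
      using insert.IH insert.prems by blast+
    have b: "scl (x (Xg i)) (bvec (Xg i)) \<in> Lev p" "bvec (Xg i) \<in> Lev p"
      using insert.prems by simp_all
    have "w (scl (x (Xg i)) (bvec (Xg i)) + ?s) =
        x (Xg i) ^ p * w (bvec (Xg i)) + (\<Sum>i\<in>I. x (Xg i) ^ p * w (bvec (Xg i)))"
      by (simp only: w_add[OF b(1) IH(1)] w_scl[OF b(2)] IH(2))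
    then show ?case
      unfolding sum.insert[OF insert.hyps] by (intro conjI Lhom_closed(2) b(1) IH(1))
  qed (simp add: \<open>w 0 = 0\<close>)
  have "x - (\<Sum>i\<in>{1..p}. scl (x (Xg i)) (bvec (Xg i))) = 0"
  proof (rule Lev_zero)
    show "x - (\<Sum>i\<in>{1..p}. scl (x (Xg i)) (bvec (Xg i))) \<in> Lev p"
      using x * by simp
    fix j assume "1 \<le> j" "j \<le> p"
    moreover have "(\<Sum>i\<in>{1..p}. scl (x (Xg i)) (bvec (Xg i))) (Xg j) = (\<Sum>i\<in>{1..p}. if i = j then x (Xg j) else 0)"
      unfolding sum_fun_apply by (rule sum.cong) (auto simp: bvec_def)
    ultimately show "(x - (\<Sum>i\<in>{1..p}. scl (x (Xg i)) (bvec (Xg i)))) (Xg j) = 0"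
      by simp
  qed
  then have "w x = w (\<Sum>i\<in>{1..p}. scl (x (Xg i)) (bvec (Xg i)))"
    by (simp only: right_minus_eq)
  also have "\<dots> = (\<Sum>i\<in>{1..p}. x (Xg i) ^ p * w (bvec (Xg i)))"
    using *[OF subset_refl] by (rule conjunct2)
  finally show ?thesis .
qed

text \<open>The definite description needs existence and uniqueness: the zero map qualifies, and a
  p-semilinear map is determined by its values on the X_i.\<close>

lemma lower_star_eq_0:
  assumes "p > 2" "f \<in> C2 p" "kills_Xp p f"
  shows "lower_star p f = 0"
  unfolding lower_star_def star_property_iff[OF assms]
proof (rule the_equality)
  show "p_semilinear p (0 :: 'a form1) \<and> (\<forall>i\<in>{1..p}. (0 :: 'a form1) (bvec (Xg i)) = 0) \<and> (\<forall>x. x \<notin> Lev p \<longrightarrow> (0 :: 'a form1) x = 0)"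
    by (simp add: p_semilinear_def)
next
  fix w :: "'a form1" assume w: "p_semilinear p w \<and> (\<forall>i\<in>{1..p}. w (bvec (Xg i)) = 0) \<and> (\<forall>x. x \<notin> Lev p \<longrightarrow> w x = 0)"
  have "w x = 0" for x
    using w p_semilinear_expand[of p w x] by (cases "x \<in> Lev p") auto
  then show "w = 0"
    by (simp add: fun_eq_iff)
qed

lemma pmap_bvec: "k \<in> {1..p} \<Longrightarrow> pmap p lam (bvec (Xg k)) = scl (lam k) (bvec (Xg p))"
proof -
  assume k: "k \<in> {1..p}"
  have "(\<Sum>i\<in>{1..p}. bvec (Xg k) (Xg i) ^ p * lam i) = (\<Sum>i\<in>{1..p}. if i = k then lam k else 0)"
    using k by (intro sum.cong) (auto simp: bvec_def)
  then show ?thesis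
    using k by (simp add: pmap_def)
qed

lemma ind2_eq_0_iff:
  assumes p: "p > 2" and lam: "\<exists>k\<in>{1..p}. lam k \<noteq> 0" and f: "f \<in> C2 p"
  shows "ind2 p lam f w = 0 \<longleftrightarrow> kills_Xp p f"
proof -
  have ind2: "ind2 p lam f w x y = f x (pmap p lam y)" if "x \<in> Lev p" "y \<in> Lev p" for x y
  proof -
    have "lbr p (x # replicate (p - 1) y) = 0"
      by (rule lbr_long[OF p]) (use that p in auto)
    then show ?thesis
      using that C2_linear_left(3)[OF f] by (simp add: ind2_def)
  qed
  show ?thesis
  proof
    assume 0: "ind2 p lam f w = 0"
    from lam obtain k where k: "k \<in> {1..p}" "lam k \<noteq> 0"
      by auto
    \<comment> \<open>The p-map sends X_k to \<lambda>_k X_p, so testing at y = X_k leaves a nonzero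
      multiple of the wanted value.\<close>
    have "lam k * f (bvec (Xg i)) (bvec (Xg p)) = 0" if "i \<in> {1..p}" for i
      using ind2[of "bvec (Xg i)" "bvec (Xg k)"] 0 that k p
      by (simp add: pmap_bvec C2_linear_right[OF f])
    then show "kills_Xp p f"
      using k by (simp add: kills_Xp_def)
  next
    assume f0: "kills_Xp p f"
    have "ind2 p lam f w x y = 0" for x y
    proof (cases "x \<in> Lev p \<and> y \<in> Lev p")
      case True
      then show ?thesis
        using ind2 kills_XpD(1)[OF p f f0, of x] p by (simp add: pmap_def C2_linear_right[OF f])
    qed (simp only: ind2_def if_False)
    then show "ind2 p lam f w = 0"
      by (simp add: fun_eq_iff)
  qed
qed

text \<open>The two components decouple: once \<open>f\<close> kills X_p, the star-property no
  longer ties \<open>w\<close> to \<open>f\<close>.\<close>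

lemma mem_Ker_iff:
  assumes p: "p > 2" and lam: "\<exists>k\<in>{1..p}. lam k \<noteq> 0"
  shows "(f, w) \<in> carrier (Ker_d2_star p lam) \<longleftrightarrow>
    f \<in> C2 p \<and> adX1_invariant p f \<and> kills_Xp p f \<and> p_semilinear p w \<and> (\<forall>x. x \<notin> Lev p \<longrightarrow> w x = 0)"
proof (cases "f \<in> C2 p")
  case True
  show ?thesis
    using star_property_iff[OF p True, of w] d2_eq_0_iff[OF p True] ind2_eq_0_iff[OF p lam True, of w]
    by (auto simp: Ker_d2_star_def C2_star_set_def d2_star_def zero_prod_def True)
qed (simp add: Ker_d2_star_def C2_star_set_def)


section \<open>The distinguished cochains\<close>

lemma C2_sum:
  assumes "\<And>r. r \<in> R \<Longrightarrow> f r \<in> C2 p"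
  shows "(\<lambda>x y. \<Sum>r\<in>R. c r * f r x y) \<in> C2 p"
  using assms
proof (induction R rule: infinite_finite_induct)
  case (insert r R)
  then have "(\<lambda>x y. c r * f r x y) + (\<lambda>x y. \<Sum>r\<in>R. c r * f r x y) \<in> C2 p"
    by (intro C2_add C2_scale) auto
  then show ?case
    using insert by (simp add: plus_fun_def)
qed (use C2_zero in \<open>simp_all add: zero_fun_def\<close>)

lemma XX_C2: "i \<noteq> j \<Longrightarrow> XX p i j \<in> C2 p"
  unfolding XX_def by (rule form_of_C2) (auto split: if_splits)

lemma XY_C2: "XY p i j \<in> C2 p"
  unfolding XY_def by (rule form_of_C2) (auto split: if_splits)

lemma YY_C2: "YY p i j \<in> C2 p"
  unfolding YY_def by (rule form_of_C2) (auto split: if_splits)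

text \<open>For odd \<open>i\<close> the indices r and i - r differ, as \<open>XX_C2\<close>
  requires.\<close>

lemma varphi_form_C2: "odd i \<Longrightarrow> varphi_form p i \<in> C2 p"
  unfolding varphi_form_def by (rule C2_sum, rule XX_C2) presburger

lemma psi_form_C2: "psi_form p j \<in> C2 p"
  unfolding psi_form_def by (rule C2_sum, rule XY_C2)

lemma phi_form_C2: "phi_form p k \<in> C2 p"
proof -
  have "(\<lambda>x y. \<Sum>t\<in>{1..k div 2 - 1}. (-1) ^ t * YY p t (k - t) x y)
      + (\<lambda>x y. (-1) ^ (k div 2) * (1 / 2) * YY p (k div 2) (k div 2) x y) \<in> C2 p"
    by (intro C2_add C2_scale C2_sum YY_C2)
  then show ?thesis
    by (simp add: phi_form_def plus_fun_def)
qed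

lemma XY_bvec:
  assumes "g \<in> gens p" "h \<in> gens p"
  shows "XY p k l (bvec g) (bvec h) =
    (if g = Xg k \<and> h = Yg l then 1 else if g = Yg l \<and> h = Xg k then - 1 else 0)"
  unfolding XY_def using assms by (rule form_of_bvec)

text \<open>The sum lists each unordered pair on the antidiagonal a + b = i once, by its smaller
  index. As \<open>i\<close> is odd, (-1)^b = - (-1)^a, so the formula (-1)^a also gives the swapped
  entries.\<close>

lemma varphi_form_bvec:
  assumes "g \<in> gens p" "h \<in> gens p" "odd i"
  shows "(varphi_form p i (bvec g) (bvec h) :: 'a::field) =
    (case (g, h) of (Xg a, Xg b) \<Rightarrow> if 2 \<le> a \<and> 2 \<le> b \<and> a + b = i then (-1) ^ a else 0 | _ \<Rightarrow> 0)"
proof -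
  have eval: "(varphi_form p i (bvec g) (bvec h) :: 'a) = (\<Sum>r\<in>{2..i div 2}. (-1) ^ r *
      (if g = Xg r \<and> h = Xg (i - r) then 1 else if g = Xg (i - r) \<and> h = Xg r then - 1 else 0))"
    unfolding varphi_form_def XX_def using assms by (simp add: form_of_bvec)
  show ?thesis
  proof (cases "\<exists>a b. g = Xg a \<and> h = Xg b")
    case True
    then obtain a b where ab: "g = Xg a" "h = Xg b"
      by blast
    have "(varphi_form p i (bvec g) (bvec h) :: 'a) =
        (\<Sum>r\<in>{2..i div 2}. if r = min a b then (if a + b = i then (-1) ^ a else 0) else 0)"
      unfolding eval
    proof (intro sum.cong refl)
      fix r assume r: "r \<in> {2..i div 2}"
      then have lt: "r < i - r" "r \<le> i"
        using \<open>odd i\<close> by (auto simp: odd_pos elim!: oddE)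
      have sign: "(-1) ^ b = - ((-1) ^ a :: 'a)" if "a + b = i"
        using that \<open>odd i\<close> by (cases "even a") auto
      show "(-1) ^ r * (if g = Xg r \<and> h = Xg (i - r) then 1 else if g = Xg (i - r) \<and> h = Xg r then - 1 else 0)
        = (if r = min a b then (if a + b = i then (-1) ^ a else (0 :: 'a)) else 0)"
        using lt sign by (auto simp: ab min_def)
    qed
    also have "\<dots> = (if 2 \<le> a \<and> 2 \<le> b \<and> a + b = i then (-1) ^ a else 0)"
      by (auto simp: min_def)
    finally show ?thesis
      by (simp add: ab)
  next
    case False
    then show ?thesis
      unfolding eval by (cases g; cases h) (auto intro!: sum.neutral)
  qed
qed

lemma psi_form_bvec:
  assumes "g \<in> gens p" "h \<in> gens p"
  shows "(psi_form p j (bvec g) (bvec h) :: 'a::field) =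
    (case (g, h) of
      (Xg a, Yg b) \<Rightarrow> if 2 \<le> a \<and> a + b = j + 1 then (-1) ^ a else 0
    | (Yg b, Xg a) \<Rightarrow> if 2 \<le> a \<and> a + b = j + 1 then - ((-1) ^ a) else 0
    | _ \<Rightarrow> 0)"
proof -
  have eval: "(psi_form p j (bvec g) (bvec h) :: 'a) = (\<Sum>s\<in>{2..j}. (-1) ^ s *
      (if g = Xg s \<and> h = Yg (j - s + 1) then 1 else if g = Yg (j - s + 1) \<and> h = Xg s then - 1 else 0))"
    unfolding psi_form_def XY_def using assms by (simp add: form_of_bvec)
  \<comment> \<open>The condition on \<open>b\<close> makes the upper bound a \<le> j automatic on
    the antidiagonal.\<close>
  have sum: "(\<Sum>s\<in>{2..j}. (-1) ^ s * (if s = a \<and> b = j - s + 1 then e else 0)) =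
      (if 2 \<le> a \<and> a + b = j + 1 then e * (-1) ^ a else 0)" if "1 \<le> b" for a b and e :: 'a
  proof -
    have "(\<Sum>s\<in>{2..j}. (-1) ^ s * (if s = a \<and> b = j - s + 1 then e else 0)) =
        (\<Sum>s\<in>{2..j}. if s = a then (if a + b = j + 1 then e * (-1) ^ a else 0) else 0)"
      by (intro sum.cong) auto
    then show ?thesis
      using that by auto
  qed
  show ?thesis
  proof (cases g; cases h)
    fix a b assume gh: "g = Xg a" "h = Yg b"
    have "(psi_form p j (bvec g) (bvec h) :: 'a) = (\<Sum>s\<in>{2..j}. (-1) ^ s * (if s = a \<and> b = j - s + 1 then 1 else 0))"
      unfolding eval by (intro sum.cong) (auto simp: gh)
    also have "\<dots> = (if 2 \<le> a \<and> a + b = j + 1 then (-1) ^ a else 0)"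
      using sum[of b a 1] assms gh by simp
    finally show ?thesis
      by (simp add: gh)
  next
    fix b a assume gh: "g = Yg b" "h = Xg a"
    have "(psi_form p j (bvec g) (bvec h) :: 'a) = (\<Sum>s\<in>{2..j}. (-1) ^ s * (if s = a \<and> b = j - s + 1 then - 1 else 0))"
      unfolding eval by (intro sum.cong) (auto simp: gh)
    also have "\<dots> = (if 2 \<le> a \<and> a + b = j + 1 then - ((-1) ^ a) else 0)"
      using sum[of b a "- 1"] assms gh by simp
    finally show ?thesis
      by (simp add: gh)
  next
    fix a b assume "g = Xg a" "h = Xg b"
    then show ?thesis
      unfolding eval by simp
  next
    fix a b assume "g = Yg a" "h = Yg b"
    then show ?thesis
      unfolding eval by simp
  qed
qed

text \<open>For even \<open>k\<close> both orders of a pair carry the same sign, matching symmetry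
  on odd vectors. The factor 1/2 cancels the value 2 of \<open>YY\<close> on the diagonal, so the
  midpoint follows the same rule.\<close>

lemma phi_form_bvec:
  assumes "g \<in> gens p" "h \<in> gens p" "even k" "(2 :: 'a::field) \<noteq> 0"
  shows "(phi_form p k (bvec g) (bvec h) :: 'a) =
    (case (g, h) of (Yg a, Yg b) \<Rightarrow> if a + b = k then (-1) ^ a else (0 :: 'a) | _ \<Rightarrow> 0)"
proof -
  obtain m where m: "k = 2 * m"
    using \<open>even k\<close> by blast
  have eval: "(phi_form p k (bvec g) (bvec h) :: 'a) = (\<Sum>t\<in>{1..m - 1}. (-1) ^ t *
      (if g = Yg t \<and> h = Yg (k - t) \<or> g = Yg (k - t) \<and> h = Yg t then (if t = k - t then 2 else 1) else 0))
      + (-1) ^ m * (if g = Yg m \<and> h = Yg m then 1 else (0 :: 'a))"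
    unfolding phi_form_def YY_def using assms by (simp add: form_of_bvec m)
  show ?thesis
  proof (cases "\<exists>a b. g = Yg a \<and> h = Yg b")
    case True
    then obtain a b where ab: "g = Yg a" "h = Yg b" "1 \<le> a" "1 \<le> b"
      using assms by auto
    have sign: "(-1) ^ b = ((-1) ^ a :: 'a)" if "a + b = k"
      using that \<open>even k\<close> by (cases "even a") auto
    have "(\<Sum>t\<in>{1..m - 1}. (-1) ^ t *
      (if g = Yg t \<and> h = Yg (k - t) \<or> g = Yg (k - t) \<and> h = Yg t then (if t = k - t then 2 else 1) else (0 :: 'a)))
      = (\<Sum>t\<in>{1..m - 1}. if t = min a b then (if a + b = k then (-1) ^ a else 0) else 0)"
    proof (intro sum.cong refl)
      fix t assume "t \<in> {1..m - 1}"
      then have lt: "t < k - t" "t \<le> k"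
        by (auto simp: m)
      show "(-1) ^ t * (if g = Yg t \<and> h = Yg (k - t) \<or> g = Yg (k - t) \<and> h = Yg t then (if t = k - t then 2 else 1) else 0)
        = (if t = min a b then (if a + b = k then (-1) ^ a else (0 :: 'a)) else 0)"
        using lt sign by (auto simp: ab min_def)
    qed
    also have "\<dots> = (if a + b = k \<and> a \<noteq> b then (-1) ^ a else 0)"
      using ab by (auto simp: m min_def)
    finally show ?thesis
      unfolding eval by (auto simp: ab m)
  next
    case False
    then show ?thesis
      unfolding eval by (cases g; cases h) (auto intro!: sum.neutral)
  qed
qed

text \<open>The conditionals encode D X_p = D Y_p = 0. The block with an odd first and an even
  second argument follows from \<open>XY\<close> by skew-symmetry.\<close>

lemma adX1_invariantI:
  assumes p: "p > 2" and f: "f \<in> C2 p"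
    and XX: "\<And>i j. 2 \<le> i \<Longrightarrow> i \<le> p \<Longrightarrow> 2 \<le> j \<Longrightarrow> j \<le> p \<Longrightarrow>
      (if i < p then f (bvec (Xg (i + 1))) (bvec (Xg j)) else 0) + (if j < p then f (bvec (Xg i)) (bvec (Xg (j + 1))) else 0) = 0"
    and XY: "\<And>i j. 2 \<le> i \<Longrightarrow> i \<le> p \<Longrightarrow> 1 \<le> j \<Longrightarrow> j \<le> p \<Longrightarrow>
      (if i < p then f (bvec (Xg (i + 1))) (bvec (Yg j)) else 0) + (if j < p then f (bvec (Xg i)) (bvec (Yg (j + 1))) else 0) = 0"
    and YY: "\<And>i j. 1 \<le> i \<Longrightarrow> i \<le> p \<Longrightarrow> 1 \<le> j \<Longrightarrow> j \<le> p \<Longrightarrow>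
      (if i < p then f (bvec (Yg (i + 1))) (bvec (Yg j)) else 0) + (if j < p then f (bvec (Yg i)) (bvec (Yg (j + 1))) else 0) = 0"
  shows "adX1_invariant p f"
proof -
  have zero: "f 0 (bvec g) = 0" "f (bvec g) 0 = 0" if "g \<in> gens p" for g
    using C2_linear_left(3)[OF f] C2_linear_right(3)[OF f] that by simp_all
  have lt: "i \<le> p - Suc 0 \<longleftrightarrow> i < p" for i
    using p by auto
  have XY': "leibniz p f (bvec (Xg i)) (bvec (Yg j)) = 0" if "2 \<le> i" "i \<le> p" "1 \<le> j" "j \<le> p" for i j
    using XY[OF that] that p by (auto simp: leibniz_def adX1_bvec zero lt split: if_splits)
  have YX': "leibniz p f (bvec (Yg j)) (bvec (Xg i)) = 0" if "2 \<le> i" "i \<le> p" "1 \<le> j" "j \<le> p" for i j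
  proof -
    have "f x y = - f y x" if "x \<in> Lhom p 1" "y \<in> Lhom p 0" for x y
      using C2_skew[OF f that] by simp
    then have "leibniz p f (bvec (Yg j)) (bvec (Xg i)) = - leibniz p f (bvec (Xg i)) (bvec (Yg j))"
      using that by (simp add: leibniz_def)
    then show ?thesis
      using XY'[OF that] by simp
  qed
  have XX': "leibniz p f (bvec (Xg i)) (bvec (Xg j)) = 0" if "2 \<le> i" "i \<le> p" "2 \<le> j" "j \<le> p" for i j
    using XX[OF that] that p by (auto simp: leibniz_def adX1_bvec zero lt split: if_splits)
  have YY': "leibniz p f (bvec (Yg i)) (bvec (Yg j)) = 0" if "1 \<le> i" "i \<le> p" "1 \<le> j" "j \<le> p" for i j
    using YY[OF that] that p by (auto simp: leibniz_def adX1_bvec zero lt split: if_splits)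
  show ?thesis
    unfolding adX1_invariant_def
  proof (intro ballI)
    fix g h assume "g \<in> gens p - {Xg 1}" "h \<in> gens p - {Xg 1}"
    then show "leibniz p f (bvec g) (bvec h) = 0"
      by (cases g; cases h) (auto intro!: XX' XY' YX' YY')
  qed
qed

lemma XY_invariant:
  assumes "p > 2"
  shows "adX1_invariant p (XY p 1 p)" "kills_Xp p (XY p 1 p)"
  using assms by (auto intro!: adX1_invariantI XY_C2 simp: XY_bvec kills_Xp_def)

text \<open>Neighbours on an antidiagonal have opposite signs and cancel. For i \<le> p, and both
  indices at least 2, the antidiagonal a + b = i does not meet the index \<open>p\<close>, which
  also gives \<open>kills_Xp\<close>.\<close>

lemma varphi_form_invariant:
  assumes "p > 2" "odd i" "i \<le> p"
  shows "adX1_invariant p (varphi_form p i)" "kills_Xp p (varphi_form p i)"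
  using assms by (auto intro!: adX1_invariantI varphi_form_C2 simp: varphi_form_bvec kills_Xp_def)

lemma psi_form_invariant:
  assumes "p > 2" "j \<le> p"
  shows "adX1_invariant p (psi_form p j)" "kills_Xp p (psi_form p j)"
  using assms by (auto intro!: adX1_invariantI psi_form_C2 simp: psi_form_bvec kills_Xp_def)

text \<open>The bound p + 1 on \<open>k\<close> keeps the antidiagonal away from the index p + 1, so
  the truncation at \<open>p\<close> cuts off no term.\<close>

lemma phi_form_invariant:
  assumes "p > 2" "even k" "k \<le> p + 1" "(2 :: 'a::field) \<noteq> 0"
  shows "adX1_invariant p (phi_form p k :: 'a form2)" "kills_Xp p (phi_form p k :: 'a form2)"
  using assms by (auto intro!: adX1_invariantI phi_form_C2 simp: phi_form_bvec kills_Xp_def)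


section \<open>Cocycles and coboundaries\<close>

text \<open>The scalar action of \<open>C2_star\<close>, made available as a vector space structure
  on the whole type of pairs.\<close>

definition rscale :: "'a::field \<Rightarrow> 'a rform2 \<Rightarrow> 'a rform2" where
  "rscale c u = (\<lambda>x y. c * fst u x y, \<lambda>x. c * snd u x)"

lemma rscale_vector_space: "Vector_Spaces.vector_space rscale"
  by unfold_locales (auto simp: rscale_def prod_eq_iff fun_eq_iff algebra_simps)

lemma Ker_add:
  assumes p: "p > 2" and lam: "\<exists>k\<in>{1..p}. lam k \<noteq> 0"
    and uv: "u \<in> carrier (Ker_d2_star p lam)" "v \<in> carrier (Ker_d2_star p lam)"
  shows "u + v \<in> carrier (Ker_d2_star p lam)"
proof -
  obtain f w f' w' where eq: "u = (f, w)" "v = (f', w')"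
    by (cases u, cases v)
  have "f + f' \<in> C2 p"
    using uv by (simp add: eq mem_Ker_iff[OF p lam] C2_add)
  moreover have "adX1_invariant p (f + f')" "kills_Xp p (f + f')"
    using uv by (auto simp: eq mem_Ker_iff[OF p lam] adX1_invariant_def leibniz_def kills_Xp_def algebra_simps)
  moreover have "p_semilinear p (w + w')" "\<forall>x. x \<notin> Lev p \<longrightarrow> (w + w') x = 0"
    using uv by (auto simp: eq mem_Ker_iff[OF p lam] p_semilinear_def algebra_simps)
  ultimately show ?thesis
    by (simp add: eq mem_Ker_iff[OF p lam])
qed

lemma Ker_scale:
  assumes p: "p > 2" and lam: "\<exists>k\<in>{1..p}. lam k \<noteq> 0" and u: "u \<in> carrier (Ker_d2_star p lam)"
  shows "rscale c u \<in> carrier (Ker_d2_star p lam)"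
proof -
  obtain f w where eq: "u = (f, w)"
    by (cases u)
  have "leibniz p (\<lambda>x y. c * f x y) = (\<lambda>x y. c * leibniz p f x y)"
    by (simp add: leibniz_def fun_eq_iff algebra_simps)
  then have "adX1_invariant p (\<lambda>x y. c * f x y)"
    using u by (auto simp: eq mem_Ker_iff[OF p lam] adX1_invariant_def)
  moreover have "kills_Xp p (\<lambda>x y. c * f x y)" "p_semilinear p (\<lambda>x. c * w x)"
    using u by (auto simp: eq mem_Ker_iff[OF p lam] kills_Xp_def p_semilinear_def algebra_simps)
  ultimately show ?thesis
    using u by (simp add: eq rscale_def mem_Ker_iff[OF p lam] C2_scale)
qed

section \<open>Coboundaries are restricted cocycles\<close>

lemma d1_apply:
  assumes "p > 2" "f \<in> C1 p" "x \<in> Lpp p" "y \<in> Lpp p"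
  shows "d1 p f x y = y (Xg 1) * f (adX1 p x) - x (Xg 1) * f (adX1 p y)"
  using assms linear_on_LD[of p f] by (simp add: d1_def br_eq C1_def)

lemma d1_C2:
  assumes p: "p > 2" and f: "f \<in> C1 p"
  shows "d1 p f \<in> C2 p"
proof -
  note lin = linear_on_LD[of p f]
  have f': "linear_on_L p f"
    using f by (simp add: C1_def)
  have "bilinear_on_L p (d1 p f)"
    unfolding bilinear_on_L_def linear_on_L_def
    by (auto simp: d1_apply[OF p f] adX1_linear lin[OF f'] algebra_simps)
  moreover have "d1 p f x y + (-1) ^ (a * b) * d1 p f y x = 0"
    if "x \<in> Lhom p a" "y \<in> Lhom p b" "a \<in> {0,1}" "b \<in> {0,1}" for x y a b
  proof -
    have "x (Xg 1) = 0 \<or> a = 0" "y (Xg 1) = 0 \<or> b = 0"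
      using that(1,2)[THEN Lhom_nonzero, of "Xg 1"] by auto
    then show ?thesis
      using that by (auto simp: d1_apply[OF p f])
  qed
  moreover have "d1 p f x y = 0" if "x \<notin> Lpp p \<or> y \<notin> Lpp p" for x y
    using that by (auto simp: d1_def)
  ultimately show ?thesis
    unfolding C2_def bilinear_on_L_def by blast
qed

lemma adX1_Xp: "adX1 p (bvec (Xg p)) = 0"
  by (auto intro!: gen_fun_eqI simp: bvec_def)

text \<open>\<open>d1 p f\<close> is supported on pairs involving X_1, which makes it invariant, and
  D X_p = 0 makes it kill X_p. That \<open>ind1\<close> is additive is the Frobenius identity in
  characteristic \<open>p\<close>.\<close>

lemma d1_star_Ker:
  fixes lam :: "nat \<Rightarrow> 'a::field"
  assumes p: "p > 2" "CHAR('a) = p" and lam: "\<exists>k\<in>{1..p}. lam k \<noteq> 0" and f: "f \<in> C1 p"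
  shows "d1_star p lam f \<in> carrier (Ker_d2_star p lam)"
proof -
  have f': "linear_on_L p f"
    using f by (simp add: C1_def)
  have Xp: "bvec (Xg p) \<in> Lpp p"
    using p by simp
  have inv: "adX1_invariant p (d1 p f)"
    unfolding adX1_invariant_def leibniz_def
    by (auto simp: d1_apply[OF p(1) f] bvec_apply)
  have kills: "kills_Xp p (d1 p f)"
    unfolding kills_Xp_def using p
    by (auto simp: d1_apply[OF p(1) f] bvec_apply adX1_Xp linear_on_LD[OF f'])
  have "prime CHAR('a)"
    using p by (intro prime_CHAR_semidom) simp
  then have frob: "(a + b) ^ p = a ^ p + b ^ p" for a b :: 'a
    using p(2) freshmans_dream by metis
  have "ind1 p lam f x = (\<Sum>k\<in>{1..p}. x (Xg k) ^ p * lam k) * f (bvec (Xg p))" if "x \<in> Lev p" for x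
    unfolding ind1_def pmap_def linear_on_LD(2)[OF f' Xp] using that by simp
  then have semi: "p_semilinear p (ind1 p lam f)"
    unfolding p_semilinear_def
    by (simp add: frob power_mult_distrib distrib_right sum.distrib sum_distrib_left mult.assoc)
  show ?thesis
    using d1_C2[OF p(1) f] inv kills semi
    by (simp add: d1_star_def mem_Ker_iff[OF p(1) lam]) (simp add: ind1_def)
qed

lemma C1_add: "f \<in> C1 p \<Longrightarrow> f' \<in> C1 p \<Longrightarrow> f + f' \<in> C1 p"
  by (auto simp: C1_def linear_on_L_def algebra_simps)

lemma C1_scale: "f \<in> C1 p \<Longrightarrow> (\<lambda>x. c * f x) \<in> C1 p"
  by (auto simp: C1_def linear_on_L_def algebra_simps)

lemma C1_zero: "0 \<in> C1 p"
  by (auto simp: C1_def linear_on_L_def)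

lemma d1_star_linear:
  "d1_star p lam (f + f') = d1_star p lam f + d1_star p lam f'"
  "d1_star p lam (\<lambda>x. c * f x) = rscale c (d1_star p lam f)"
  "d1_star p lam 0 = 0"
  by (auto simp: d1_star_def d1_def ind1_def rscale_def fun_eq_iff zero_prod_def)

lemma H2_subspace_quotient:
  fixes lam :: "nat \<Rightarrow> 'a::field"
  assumes p: "p > 2" "CHAR('a) = p" and lam: "\<exists>k\<in>{1..p}. lam k \<noteq> 0"
  shows "subspace_quotient rscale (carrier (Ker_d2_star p lam)) (Im_d1_star p lam) (Ker_d2_star p lam)"
proof (intro subspace_quotient.intro subspace_quotient_axioms.intro rscale_vector_space)
  show "Im_d1_star p lam \<subseteq> carrier (Ker_d2_star p lam)"
    using d1_star_Ker[OF p lam] by (auto simp: Im_d1_star_def)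
  show "0 \<in> Im_d1_star p lam"
    unfolding Im_d1_star_def by (rule image_eqI[where x = 0]) (simp_all add: d1_star_linear(3) C1_zero)
  show "u + v \<in> Im_d1_star p lam" if "u \<in> Im_d1_star p lam" "v \<in> Im_d1_star p lam" for u v
    using that unfolding Im_d1_star_def by (auto simp: d1_star_linear(1)[symmetric] intro!: imageI C1_add)
  show "rscale c u \<in> Im_d1_star p lam" if "u \<in> Im_d1_star p lam" for c u
    using that unfolding Im_d1_star_def by (auto simp: d1_star_linear(2)[symmetric] intro!: imageI C1_scale)
qed (use Ker_add[OF p(1) lam] Ker_scale[OF p(1) lam] in
    \<open>auto simp: Ker_d2_star_def C2_star_def rscale_def split: prod.splits\<close>)


section \<open>Invariant forms are determined by few values\<close>

text \<open>Each step moves one unit from the first index to the second and costs a sign. The second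
  index grows on the way, hence the generalisation over \<open>j\<close>.\<close>

lemma shift_recursion:
  fixes F :: "nat \<Rightarrow> nat \<Rightarrow> 'a::ring_1"
  assumes "\<And>i j. a \<le> i \<Longrightarrow> b \<le> j \<Longrightarrow> F (Suc i) j = - F i (Suc j)" and "b \<le> j"
  shows "F (a + k) j = (-1) ^ k * F a (j + k)"
  using assms(2)
proof (induction k arbitrary: j)
  case (Suc k)
  have "F (a + Suc k) j = - F (a + k) (Suc j)"
    using assms(1)[of "a + k" j] Suc.prems by simp
  also have "\<dots> = - ((-1) ^ k * F a (Suc j + k))"
    using Suc.IH[of "Suc j"] Suc.prems by simp
  finally show ?case
    by simp
qed simp

text \<open>The hypotheses and the parity arguments leave \<open>f\<close> supported on pairs
  involving X_1. Such an \<open>f\<close> equals d^1 \<phi> as soon as \<phi>(D h) = - f(X_1, h),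
  which is solvable because f(X_1, -) vanishes on the kernel of D, spanned by X_1, X_p and
  Y_p.\<close>

lemma coboundaryI:
  fixes lam :: "nat \<Rightarrow> 'a::field"
  assumes p: "p > 2" and two: "(2 :: 'a) \<noteq> 0" and f: "f \<in> C2 p" "adX1_invariant p f" "kills_Xp p f"
    and w: "p_semilinear p w" "\<And>x. x \<notin> Lev p \<Longrightarrow> w x = 0"
    and X1Yp: "f (bvec (Xg 1)) (bvec (Yg p)) = 0"
    and X2X: "\<And>m. odd m \<Longrightarrow> 3 \<le> m \<Longrightarrow> m < p \<Longrightarrow> f (bvec (Xg 2)) (bvec (Xg m)) = 0"
    and X2Y: "\<And>m. 1 \<le> m \<Longrightarrow> m < p \<Longrightarrow> f (bvec (Xg 2)) (bvec (Yg m)) = 0"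
    and Y1Y: "\<And>m. odd m \<Longrightarrow> m \<le> p \<Longrightarrow> f (bvec (Yg 1)) (bvec (Yg m)) = 0"
    and wX: "\<And>i. 1 \<le> i \<Longrightarrow> i \<le> p \<Longrightarrow> w (bvec (Xg i)) = - lam i * f (bvec (Xg 1)) (bvec (Xg (p - 1)))"
  shows "(f, w) \<in> Im_d1_star p lam"
proof -
  \<comment> \<open>Setting \<open>X\<^sub>i = Y\<^sub>i = 0\<close> for \<open>i > p\<close> makes the recursion uniform up to the boundary.\<close>
  define xb yb :: "nat \<Rightarrow> 'a elt" where
    "xb i = (if i \<le> p then bvec (Xg i) else 0)" and "yb i = (if i \<le> p then bvec (Yg i) else 0)" for i
  have xb: "1 \<le> i \<Longrightarrow> xb i \<in> Lhom p 0" and yb: "1 \<le> i \<Longrightarrow> yb i \<in> Lhom p 1" for i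
    by (auto simp: xb_def yb_def)
  have xb_L: "1 \<le> i \<Longrightarrow> xb i \<in> Lpp p" and yb_L: "1 \<le> i \<Longrightarrow> yb i \<in> Lpp p" for i
    using xb yb Lhom_Lpp by blast+
  have zero: "f 0 x = 0" "f x 0 = 0" if "x \<in> Lpp p" for x
    using C2_linear_left(3)[OF f(1)] C2_linear_right(3)[OF f(1)] that by auto
  have ad: "2 \<le> i \<Longrightarrow> adX1 p (xb i) = xb (Suc i)" "1 \<le> i \<Longrightarrow> adX1 p (yb i) = yb (Suc i)" for i
    using p by (auto simp: xb_def yb_def adX1_linear adX1_bvec)
  have no_X1: "2 \<le> i \<Longrightarrow> xb i (Xg 1) = 0" "yb i (Xg 1) = 0" for i
    by (auto simp: xb_def yb_def bvec_apply)
  have shift: "f (adX1 p u) v = - f u (adX1 p v)"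
    if "u \<in> Lpp p" "v \<in> Lpp p" "u (Xg 1) = 0" "v (Xg 1) = 0" for u v
    using leibniz_invariant[OF p f(1,2) that(1,2)] that(3,4) by (simp add: leibniz_def eq_neg_iff_add_eq_0)
  \<comment> \<open>Reading \<open>ad\<close> backwards turns a successor index into an application
    of \<open>adX1\<close>, to which \<open>shift\<close> applies.\<close>
  have XX: "f (xb (2 + k)) (xb j) = (-1) ^ k * f (xb 2) (xb (j + k))" if "2 \<le> j" for j k
    by (rule shift_recursion[where F = "\<lambda>i j. f (xb i) (xb j)", OF _ that])
      (use shift xb_L no_X1 in \<open>simp flip: ad\<close>)
  have XY: "f (xb (2 + k)) (yb j) = (-1) ^ k * f (xb 2) (yb (j + k))" if "1 \<le> j" for j k
    by (rule shift_recursion[where F = "\<lambda>i j. f (xb i) (yb j)", OF _ that])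
      (use shift xb_L yb_L no_X1 in \<open>simp flip: ad\<close>)
  have YY: "f (yb (1 + k)) (yb j) = (-1) ^ k * f (yb 1) (yb (j + k))" if "1 \<le> j" for j k
    by (rule shift_recursion[where F = "\<lambda>i j. f (yb i) (yb j)", OF _ that])
      (use shift yb_L no_X1 in \<open>simp flip: ad\<close>)
  have twice: "a = 0" if "a = - a" for a :: 'a
    using that two by (metis add_eq_0_iff2 mult_2 mult_eq_0_iff)
  have X2_xb: "f (xb 2) (xb m) = 0" if "2 \<le> m" for m
  proof -
    consider "m > p" | "m = p" | "odd m" "m < p" | "even m"
      by linarith
    then show ?thesis
    proof cases
      case 1
      then show ?thesis using zero xb_L[of 2] by (simp add: xb_def)
    next
      case 2
      then show ?thesis
        using kills_XpD(1)[OF p f(1,3) xb[of 2]] by (simp add: xb_def)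
    next
      case 3
      then have "m \<noteq> 2"
        by auto
      then show ?thesis
        using 3 X2X[of m] that p by (simp add: xb_def)
    next
      case 4
      \<comment> \<open>An even number of shifts gives the plus sign, against the minus sign of
        skew-symmetry.\<close>
      have "f (xb m) (xb 2) = f (xb 2) (xb m)"
        using XX[of 2 "m - 2"] 4 le_add_diff_inverse[OF that] by (simp add: add.commute del: add_2_eq_Suc add_2_eq_Suc')
      moreover have "f (xb m) (xb 2) = - f (xb 2) (xb m)"
        using C2_skew[OF f(1) xb xb, of m 2] that by simp
      ultimately show ?thesis
        by (intro twice) simp
    qed
  qed
  have X2_yb: "f (xb 2) (yb m) = 0" if "1 \<le> m" for m
  proof -
    consider "m > p" | "m = p" | "m < p"
      by linarith
    then show ?thesis
    proof cases
      case 1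
      then show ?thesis using zero xb_L[of 2] by (simp add: yb_def)
    next
      case 2
      \<comment> \<open>X_{p+1} = 0; moving back along the antidiagonal transports this zero to
        (X_2, Y_p).\<close>
      have "f (xb (2 + (p - 1))) (yb 1) = 0"
        using zero yb_L[of 1] by (simp add: xb_def)
      then show ?thesis
        using XY[of 1 "p - 1"] p 2 by simp
    next
      case 3
      then show ?thesis
        using X2Y[of m] that p by (simp add: xb_def yb_def)
    qed
  qed
  have Y1_yb: "f (yb 1) (yb m) = 0" if "1 \<le> m" for m
  proof -
    consider "m > p" | "odd m" "m \<le> p" | "even m"
      by linarith
    then show ?thesis
    proof cases
      case 1
      then show ?thesis using zero yb_L[of 1] by (simp add: yb_def)
    next
      case 2
      then show ?thesis
        using Y1Y[of m] p by (simp add: yb_def)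
    next
      case 3
      \<comment> \<open>Here m - 1 is odd, so the shifts give a minus sign, against the symmetry of
        \<open>f\<close> on odd vectors.\<close>
      have "f (yb m) (yb 1) = - f (yb 1) (yb m)"
        using YY[of 1 "m - 1"] 3 that by simp
      moreover have "f (yb m) (yb 1) = f (yb 1) (yb m)"
        using C2_skew[OF f(1) yb yb, of m 1] that by simp
      ultimately show ?thesis
        by (intro twice) simp
    qed
  qed
  have f_XX: "f (bvec (Xg i)) (bvec (Xg j)) = 0" if "2 \<le> i" "i \<le> p" "2 \<le> j" "j \<le> p" for i j
  proof -
    from \<open>2 \<le> i\<close> obtain k where "i = 2 + k"
      by (auto simp: le_iff_add)
    then show ?thesis
      using XX[of j k] X2_xb[of "j + k"] that by (simp add: xb_def)
  qed
  have f_XY: "f (bvec (Xg i)) (bvec (Yg j)) = 0" if "2 \<le> i" "i \<le> p" "1 \<le> j" "j \<le> p" for i j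
  proof -
    from \<open>2 \<le> i\<close> obtain k where "i = 2 + k"
      by (auto simp: le_iff_add)
    then show ?thesis
      using XY[of j k] X2_yb[of "j + k"] that by (simp add: xb_def yb_def)
  qed
  have f_YY: "f (bvec (Yg i)) (bvec (Yg j)) = 0" if "1 \<le> i" "i \<le> p" "1 \<le> j" "j \<le> p" for i j
  proof -
    from \<open>1 \<le> i\<close> obtain k where "i = 1 + k"
      by (auto simp: le_iff_add)
    then show ?thesis
      using YY[of j k] Y1_yb[of "j + k"] that by (simp add: yb_def)
  qed
  \<comment> \<open>Solves \<phi>(D h) = - f(X_1, h), using X_i = D X_{i-1} and Y_j = D Y_{j-1}. On
    X_1, X_2 and Y_1, outside the image of D, the value is free and set to 0.\<close>
  define c where "c g = (case g of
      Xg i \<Rightarrow> if 3 \<le> i then - f (bvec (Xg 1)) (bvec (Xg (i - 1))) else 0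
    | Yg j \<Rightarrow> if 2 \<le> j then - f (bvec (Xg 1)) (bvec (Yg (j - 1))) else 0)" for g
  define \<phi> where "\<phi> x = (if x \<in> Lpp p then \<Sum>g\<in>gens p. x g * c g else 0)" for x
  have \<phi>: "\<phi> \<in> C1 p"
    using linear_on_L_sum[of p c] by (simp add: C1_def \<phi>_def linear_on_L_def)
  have \<phi>_bvec: "\<phi> (bvec g) = c g" if "g \<in> gens p" for g
  proof -
    have "(\<Sum>h\<in>gens p. bvec g h * c h) = (\<Sum>h\<in>gens p. if h = g then c g else 0)"
      by (intro sum.cong) (auto simp: bvec_def)
    then show ?thesis
      using that by (simp add: \<phi>_def)
  qed
  have \<phi>_0: "\<phi> 0 = 0"
    by (simp add: \<phi>_def)
  have f_X1X1: "f (bvec (Xg 1)) (bvec (Xg 1)) = 0"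
    using C2_skew[OF f(1), of "bvec (Xg 1)" 0 "bvec (Xg 1)" 0] p by (intro twice) simp
  have f_X1Xp: "f (bvec (Xg 1)) (bvec (Xg p)) = 0"
    using f(3) p by (simp add: kills_Xp_def)
  have d1_X1: "f (bvec (Xg 1)) (bvec h) = d1 p \<phi> (bvec (Xg 1)) (bvec h)" if h: "h \<in> gens p" for h
  proof -
    have d1: "d1 p \<phi> (bvec (Xg 1)) (bvec h) = - \<phi> (adX1 p (bvec h))"
      using p h by (simp add: d1_apply[OF p \<phi>] \<phi>_0 bvec_apply)
    show ?thesis
    proof (cases h)
      case (Xg i)
      with h consider "i = 1" | "2 \<le> i" "i < p" | "i = p"
        by fastforce
      then show ?thesis
      proof cases
        case 1
        then show ?thesis
          unfolding d1 using f_X1X1 \<phi>_0 by (simp add: Xg)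
      next
        case 2
        then have ad: "adX1 p (bvec h) = (bvec (Xg (i + 1)) :: 'a elt)"
          using p by (simp add: Xg adX1_bvec)
        show ?thesis
          unfolding d1 ad using \<phi>_bvec[of "Xg (i + 1)"] 2 by (simp add: Xg c_def)
      next
        case 3
        then show ?thesis
          unfolding d1 using f_X1Xp \<phi>_0 by (simp add: Xg adX1_Xp)
      qed
    next
      case (Yg i)
      with h consider "i < p" "1 \<le> i" | "i = p"
        by fastforce
      then show ?thesis
      proof cases
        case 1
        then have ad: "adX1 p (bvec h) = (bvec (Yg (i + 1)) :: 'a elt)"
          using p by (simp add: Yg adX1_bvec)
        show ?thesis
          unfolding d1 ad using \<phi>_bvec[of "Yg (i + 1)"] 1 by (simp add: Yg c_def)
      next
        case 2
        then have ad: "adX1 p (bvec h) = (0 :: 'a elt)"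
          using p by (simp add: Yg adX1_bvec)
        show ?thesis
          unfolding d1 ad using X1Yp \<phi>_0 2 by (simp add: Yg)
      qed
    qed
  qed
  have "f = d1 p \<phi>"
  proof (rule C2_eqI[OF f(1) d1_C2[OF p \<phi>]])
    fix g h assume gh: "g \<in> gens p" "h \<in> gens p"
    have par: "parity g \<in> {0, 1}" "parity h \<in> {0, 1}"
      by (cases g; simp) (cases h; simp)
    have X1: "bvec (Xg 1) \<in> Lhom p 0"
      using p by simp
    consider "g = Xg 1" | "h = Xg 1" | "g \<noteq> Xg 1" "h \<noteq> Xg 1"
      by blast
    then show "f (bvec g) (bvec h) = d1 p \<phi> (bvec g) (bvec h)"
    proof cases
      case 1
      then show ?thesis using d1_X1 gh by simp
    next
      case 2
      have *: "k (bvec g) (bvec (Xg 1)) = - k (bvec (Xg 1)) (bvec g)" if "k \<in> C2 p" for k :: "'a form2"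
        using C2_skew[OF that _ X1, of "bvec g" "parity g"] gh par by simp
      show ?thesis
        using 2 *[OF f(1)] *[OF d1_C2[OF p \<phi>]] d1_X1[OF gh(1)] by simp
    next
      case 3
      have "d1 p \<phi> (bvec g) (bvec h) = 0"
        using gh 3 by (simp add: d1_apply[OF p \<phi>] bvec_apply)
      moreover have "f (bvec g) (bvec h) = 0"
      proof (cases g)
        case (Xg i)
        then have i: "2 \<le> i" "i \<le> p"
          using gh(1) 3(1) by auto
        show ?thesis
        proof (cases h)
          case (Xg j)
          then have "2 \<le> j" "j \<le> p"
            using gh(2) 3(2) by auto
          then show ?thesis
            using f_XX[OF i] by (simp add: Xg \<open>g = Xg i\<close>)
        next
          case (Yg j)
          then show ?thesis
            using f_XY[OF i, of j] gh(2) by (simp add: \<open>g = Xg i\<close>)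
        qed
      next
        case (Yg i)
        show ?thesis
        proof (cases h)
          case (Xg j)
          then have "2 \<le> j" "j \<le> p"
            using gh(2) 3(2) by auto
          then have "f (bvec h) (bvec g) = 0"
            using f_XY[of j i] gh(1) by (simp add: Xg Yg)
          then show ?thesis
            using C2_skew[OF f(1), of "bvec g" "parity g" "bvec h" "parity h"] gh par by simp
        next
          case (Yg j)
          then show ?thesis
            using f_YY[of i j] gh by (simp add: \<open>g = Yg i\<close>)
        qed
      qed
      ultimately show ?thesis by simp
    qed
  qed
  moreover have "w = ind1 p lam \<phi>"
  proof
    fix x
    \<comment> \<open>The hypothesis \<open>wX\<close> is shaped by this value: with it,
      \<open>w\<close> and \<open>ind1 p lam \<phi>\<close> agree on every X_i.\<close>
    have \<phi>_Xp: "\<phi> (bvec (Xg p)) = - f (bvec (Xg 1)) (bvec (Xg (p - 1)))"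
      using p \<phi>_bvec[of "Xg p"] by (simp add: c_def)
    have "linear_on_L p \<phi>"
      using \<phi> by (simp add: C1_def)
    then have "\<phi> (pmap p lam x) = (\<Sum>i\<in>{1..p}. x (Xg i) ^ p * lam i) * \<phi> (bvec (Xg p))"
      unfolding pmap_def by (rule linear_on_LD(2)) (use p in simp)
    moreover have "w x = (\<Sum>i\<in>{1..p}. x (Xg i) ^ p * lam i) * \<phi> (bvec (Xg p))" if "x \<in> Lev p"
      unfolding p_semilinear_expand[OF w(1) that] sum_distrib_right
      by (intro sum.cong refl) (simp add: wX \<phi>_Xp)
    ultimately show "w x = ind1 p lam \<phi> x"
      using w(2)[of x] by (simp add: ind1_def)
  qed
  ultimately show ?thesis
    using \<phi> by (auto simp: Im_d1_star_def d1_star_def)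
qed


section \<open>The basis\<close>

text \<open>With formal labels, duality and counting become statements about constructors, and
  distinctness of the cocycles never has to be checked by hand.\<close>

datatype cocycle_index = I_XY | I_varphi nat | I_psi nat | I_phi nat | I_star nat

definition cocycle_indices :: "nat \<Rightarrow> cocycle_index set" where
  "cocycle_indices p = {I_XY} \<union> I_varphi ` {i \<in> {5..p}. odd i} \<union> I_psi ` {2..p}
     \<union> I_phi ` {k \<in> {2..p + 1}. even k} \<union> I_star ` {1..p}"

text \<open>The zeros in the second component anticipate that the starred companions vanish.\<close>

fun cocycle :: "nat \<Rightarrow> cocycle_index \<Rightarrow> 'a::field rform2" where
  "cocycle p I_XY = (XY p 1 p, 0)"
| "cocycle p (I_varphi i) = (varphi_form p i, 0)"
| "cocycle p (I_psi j) = (psi_form p j, 0)"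
| "cocycle p (I_phi k) = (phi_form p k, 0)"
| "cocycle p (I_star i) = (0, X_star p i)"

text \<open>For a coboundary \<open>(d\<^sup>1 f, ind\<^sup>1 f)\<close> the value of the second component at \<open>X\<^sub>i\<close> is \<open>\<lambda>\<^sub>i f(X\<^sub>p)\<close>,
  and \<open>f(X\<^sub>p) = - d\<^sup>1 f(X\<^sub>1, X\<^sub>p\<^sub>-\<^sub>1)\<close>: this is the origin of the correction term in the last equation.\<close>

fun coordinate :: "nat \<Rightarrow> (nat \<Rightarrow> 'a::field) \<Rightarrow> cocycle_index \<Rightarrow> 'a rform2 \<Rightarrow> 'a" where
  "coordinate p lam I_XY (f, w) = f (bvec (Xg 1)) (bvec (Yg p))"
| "coordinate p lam (I_varphi i) (f, w) = f (bvec (Xg 2)) (bvec (Xg (i - 2)))"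
| "coordinate p lam (I_psi j) (f, w) = f (bvec (Xg 2)) (bvec (Yg (j - 1)))"
| "coordinate p lam (I_phi k) (f, w) = - f (bvec (Yg 1)) (bvec (Yg (k - 1)))"
| "coordinate p lam (I_star i) (f, w) = w (bvec (Xg i)) + lam i * f (bvec (Xg 1)) (bvec (Xg (p - 1)))"

lemma coordinate_linear:
  "coordinate p lam i (u + v) = coordinate p lam i u + coordinate p lam i v"
  "coordinate p lam i (rscale c u) = c * coordinate p lam i u"
  by (cases i; cases u; cases v; simp add: rscale_def algebra_simps)+

lemma card_cocycle_indices:
  assumes "odd p" "p > 2"
  shows "finite (cocycle_indices p)" and "card (cocycle_indices p) = 3 * p - 1"
proof -
  \<comment> \<open>With p = 2q + 1 the two families restricted by parity have q - 1 and q + 1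
    members.\<close>
  from assms obtain q where q: "p = 2 * q + 1" "q \<ge> 1"
    by (elim oddE) auto
  have "i \<in> (\<lambda>m. 2 * m + 3) ` {1..q - 1}" if i: "i \<in> {5..p}" "odd i" for i
  proof -
    from i obtain b where "i = 2 * b + 1"
      by (elim oddE)
    then show ?thesis
      using i q by (intro image_eqI[of _ _ "b - 1"]) auto
  qed
  then have "{i \<in> {5..p}. odd i} = (\<lambda>m. 2 * m + 3) ` {1..q - 1}"
    using q by auto
  then have varphi: "card {i \<in> {5..p}. odd i} = q - 1"
    by (simp add: card_image inj_on_def)
  have "{k \<in> {2..p + 1}. even k} = (\<lambda>m. 2 * m) ` {1..q + 1}"
    using q by (auto elim!: evenE)
  then have phi: "card {k \<in> {2..p + 1}. even k} = q + 1"
    by (simp add: card_image inj_on_def)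
  show "finite (cocycle_indices p)"
    by (simp add: cocycle_indices_def)
  have "card (cocycle_indices p) = 1 + (q - 1) + (p - 1) + (q + 1) + p"
    unfolding cocycle_indices_def
    using varphi phi by (subst card_Un_disjoint, simp, simp, fastforce)+ (simp add: card_image inj_on_def)
  then show "card (cocycle_indices p) = 3 * p - 1"
    using q by simp
qed

lemma X_star_semilinear:
  assumes "p > 2" "CHAR('a::field) = p"
  shows "p_semilinear p (X_star p i :: 'a form1)"
proof -
  have "prime CHAR('a)"
    using assms by (intro prime_CHAR_semidom) simp
  then have "(a + b) ^ p = a ^ p + b ^ p" for a b :: 'a
    using assms(2) freshmans_dream by metis
  then show ?thesis
    by (simp add: p_semilinear_def X_star_def power_mult_distrib)
qed

lemma XX_bvec:
  assumes "g \<in> gens p" "h \<in> gens p"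
  shows "XX p i j (bvec g) (bvec h) =
    (if g = Xg i \<and> h = Xg j then 1 else if g = Xg j \<and> h = Xg i then - 1 else 0)"
  unfolding XX_def using assms by (rule form_of_bvec)

lemma zero_invariant: "adX1_invariant p 0" "kills_Xp p 0"
  by (simp_all add: adX1_invariant_def leibniz_def kills_Xp_def)

lemma cocycle_Ker:
  fixes lam :: "nat \<Rightarrow> 'a::field"
  assumes p: "p > 2" "CHAR('a) = p" and two: "(2 :: 'a) \<noteq> 0" and lam: "\<exists>k\<in>{1..p}. lam k \<noteq> 0"
    and i: "i \<in> cocycle_indices p"
  shows "cocycle p i \<in> carrier (Ker_d2_star p lam)"
proof -
  have "p_semilinear p (0 :: 'a form1)"
    by (simp add: p_semilinear_def)
  moreover have "\<forall>x. x \<notin> Lev p \<longrightarrow> X_star p j x = (0 :: 'a)" for j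
    by (simp add: X_star_def)
  ultimately show ?thesis
    using i p(1) two
    by (auto simp: cocycle_indices_def mem_Ker_iff[OF p(1) lam] XY_C2 varphi_form_C2 psi_form_C2 phi_form_C2
        C2_zero zero_invariant X_star_semilinear[OF p] XY_invariant varphi_form_invariant psi_form_invariant
        phi_form_invariant simp del: One_nat_def)
qed

text \<open>Facts on truncated subtraction, in the shapes that simplification leaves in the case
  distinctions over indices.\<close>

lemma index_arith:
  fixes m p :: nat
  shows "5 \<le> m \<Longrightarrow> Suc 0 \<le> m - 2" "5 \<le> m \<Longrightarrow> 2 \<le> m - 2" "5 \<le> m \<Longrightarrow> m - 2 \<noteq> Suc 0"
    "m \<le> p \<Longrightarrow> m - 2 \<le> p" "5 \<le> m \<Longrightarrow> Suc (Suc (m - 2)) = m"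
    "2 \<le> m \<Longrightarrow> Suc 0 \<le> m - Suc 0" "m \<le> p \<Longrightarrow> m - Suc 0 \<le> p" "m \<le> Suc p \<Longrightarrow> m - Suc 0 \<le> p"
    "2 \<le> m \<Longrightarrow> Suc (m - Suc 0) = m" "2 < m \<Longrightarrow> Suc 0 \<le> m - Suc 0"
  by auto

text \<open>With the first index fixed, an antidiagonal is determined by the second. The diagonal
  values are (-1)^2 for first index 2 and (-1)^1 for first index 1; the latter accounts for the
  minus sign at \<open>I_phi\<close>.\<close>

lemma coordinate_cocycle:
  fixes lam :: "nat \<Rightarrow> 'a::field"
  assumes p: "p > 2" and two: "(2 :: 'a) \<noteq> 0"
    and ij: "i \<in> cocycle_indices p" "j \<in> cocycle_indices p"
  shows "coordinate p lam i (cocycle p j) = (if i = j then 1 else 0)"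
proof -
  have X_star: "X_star p k (bvec (Xg l)) = (if k = l then 1 else (0 :: 'a))" if "1 \<le> l" "l \<le> p" for k l
    using that p by (auto simp: X_star_def bvec_apply)
  have "p - 1 \<noteq> 0" "p - 1 < p"
    using p by auto
  with ij p two show ?thesis
    unfolding cocycle_indices_def
    by (cases i; cases j)
      (auto simp: XY_bvec varphi_form_bvec psi_form_bvec phi_form_bvec X_star index_arith)
qed

text \<open>The evaluation pairs of \<open>I_varphi\<close>, \<open>I_psi\<close> and
  \<open>I_phi\<close> avoid X_1, and \<open>I_XY\<close> uses D Y_p = 0. For \<open>I_star\<close>
  the correction term cancels the value of \<open>ind1\<close>.\<close>

lemma coordinate_coboundary:
  fixes lam :: "nat \<Rightarrow> 'a::field"
  assumes p: "p > 2" and i: "i \<in> cocycle_indices p" and v: "v \<in> Im_d1_star p lam"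
  shows "coordinate p lam i v = 0"
proof -
  obtain f where f: "f \<in> C1 p" "v = (d1 p f, ind1 p lam f)"
    using v by (auto simp: Im_d1_star_def d1_star_def)
  have lin: "linear_on_L p f"
    using f by (simp add: C1_def)
  have ad: "adX1 p (bvec (Yg p)) = (0 :: 'a elt)" "adX1 p (bvec (Xg (p - 1))) = (bvec (Xg p) :: 'a elt)"
    using p by (simp_all add: adX1_bvec)
  have "ind1 p lam f (bvec (Xg k)) = lam k * f (bvec (Xg p))" if "k \<in> {1..p}" for k
    using that p pmap_bvec[OF that, of lam] linear_on_LD(2)[OF lin, of "bvec (Xg p)"] by (simp add: ind1_def)
  then show ?thesis
    using i p linear_on_LD(3)[OF lin] ad unfolding f(2) cocycle_indices_def
    by (auto simp: d1_apply[OF p f(1)] bvec_apply index_arith)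
qed

lemma coordinates_separate:
  fixes lam :: "nat \<Rightarrow> 'a::field"
  assumes p: "p > 2" "odd p" and two: "(2 :: 'a) \<noteq> 0" and lam: "\<exists>k\<in>{1..p}. lam k \<noteq> 0"
    and v: "v \<in> carrier (Ker_d2_star p lam)"
    and 0: "\<And>i. i \<in> cocycle_indices p \<Longrightarrow> coordinate p lam i v = 0"
  shows "v \<in> Im_d1_star p lam"
proof -
  obtain f w where fw: "v = (f, w)"
    by (cases v)
  have "f (bvec (Xg 1)) (bvec (Yg p)) = 0"
    using 0[of I_XY] by (simp add: fw cocycle_indices_def)
  \<comment> \<open>Since \<open>m\<close> and \<open>p\<close> are both odd, m < p gives m + 2
    \<le> p, so the index m + 2 is in range.\<close>
  moreover have "f (bvec (Xg 2)) (bvec (Xg m)) = 0" if "odd m" "3 \<le> m" "m < p" for m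
    using 0[of "I_varphi (m + 2)"] that p by (auto simp: fw cocycle_indices_def elim!: oddE)
  moreover have "f (bvec (Xg 2)) (bvec (Yg m)) = 0" if "1 \<le> m" "m < p" for m
    using 0[of "I_psi (m + 1)"] that by (auto simp: fw cocycle_indices_def)
  moreover have "f (bvec (Yg 1)) (bvec (Yg m)) = 0" if "odd m" "m \<le> p" for m
    using 0[of "I_phi (m + 1)"] that by (auto simp: fw cocycle_indices_def elim!: oddE)
  moreover have "w (bvec (Xg i)) = - lam i * f (bvec (Xg 1)) (bvec (Xg (p - 1)))" if "1 \<le> i" "i \<le> p" for i
    using 0[of "I_star i"] that by (auto simp: fw cocycle_indices_def eq_neg_iff_add_eq_0)
  ultimately show ?thesis
    using v unfolding fw mem_Ker_iff[OF p(1) lam] by (intro coboundaryI[OF p(1) two]) auto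
qed

text \<open>The set difference removes exactly the two named forms only if neither coincides with a
  retained one. \<open>kills_Xp\<close> separates them: the retained forms satisfy it, the removed
  ones take the value 1 at (X_1, X_p) and (X_2, X_p).\<close>

lemma basis_cocycles_eq:
  assumes p: "p > 2" "odd p" and two: "(2 :: 'a::field) \<noteq> 0"
  shows "(basis_cocycles p :: 'a rform2 set) = cocycle p ` cocycle_indices p"
proof -
  define R :: "'a form2 set" where
    "R = {XY p 1 p} \<union> varphi_form p ` {i \<in> {5..p}. odd i} \<union> psi_form p ` {2..p}
      \<union> phi_form p ` {k \<in> {2..p + 1}. even k}"
  have R: "f \<in> C2 p \<and> kills_Xp p f" if "f \<in> R" for f
    using that p two unfolding R_def
    by (auto simp: XY_C2 varphi_form_C2 psi_form_C2 phi_form_C2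
        XY_invariant varphi_form_invariant psi_form_invariant phi_form_invariant simp del: One_nat_def)
  have "\<not> kills_Xp p (XX p 1 p :: 'a form2)"
    unfolding kills_Xp_def using p by (auto intro!: bexI[of _ 1] simp: XX_bvec)
  then have notin1: "XX p 1 p \<notin> R"
    using R by blast
  have "\<not> kills_Xp p (varphi_form p (p + 2) :: 'a form2)"
    unfolding kills_Xp_def using p by (auto intro!: bexI[of _ 2] simp: varphi_form_bvec)
  then have notin2: "varphi_form p (p + 2) \<notin> R"
    using R by blast
  have "{i \<in> {5..p + 2}. odd i} = insert (p + 2) {i \<in> {5..p}. odd i}"
    using p by (auto simp: le_Suc_eq)
  then have "Omega4 p = {XX p 1 p, varphi_form p (p + 2)} \<union> R"
    unfolding Omega4_def R_def by (simp only: image_insert) blast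
  then have "Omega4 p - {XX p 1 p, varphi_form p (p + 2)} = R"
    using notin1 notin2 by (simp add: insert_Diff_if)
  then have "basis_cocycles p = (\<lambda>f. (f, lower_star p f)) ` R \<union> (\<lambda>i. (0, X_star p i)) ` {1..p}"
    unfolding basis_cocycles_def by auto
  also have "(\<lambda>f. (f, lower_star p f)) ` R = (\<lambda>f. (f, 0)) ` R"
    using R p by (intro image_cong refl) (simp add: lower_star_eq_0)
  finally show ?thesis
    by (simp add: R_def cocycle_indices_def image_Un image_image zero_fun_def)
qed

theorem theorem4p4:
  fixes p :: nat and lam :: "nat \<Rightarrow> 'a::alg_closed_field"
  assumes "CHAR('a) = p" and "p > 2"
    and "\<exists>k\<in>{1..p}. lam k \<noteq> 0"
  shows "vectorspace (class_ring :: 'a ring) (H2_star p lam) \<and>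
     vectorspace.dim (class_ring :: 'a ring) (H2_star p lam) = 3 * p - 1 \<and>
     basis_cocycles p \<subseteq> carrier (Ker_d2_star p lam) \<and>
     inj_on (cohom_class p lam) (basis_cocycles p) \<and>
     vectorspace.basis (class_ring :: 'a ring) (H2_star p lam)
           (cohom_class p lam ` basis_cocycles p)"
proof -
  \<comment> \<open>A positive characteristic of a field is prime. With p > 2 this makes
    \<open>p\<close> odd, as the index ranges require, and 2 invertible, as the parity arguments
    require.\<close>
  have "prime CHAR('a)"
    using assms(1,2) by (intro prime_CHAR_semidom) simp
  then have odd: "odd p"
    using assms(1,2) prime_odd_nat by blast
  have "\<not> CHAR('a) dvd 2"
    using assms by (auto dest: dvd_imp_le)
  then have two: "(2 :: 'a) \<noteq> 0"
    using of_nat_eq_0_iff_char_dvd[of 2, where ?'a = 'a] by simp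
  interpret subspace_quotient rscale "carrier (Ker_d2_star p lam)" "Im_d1_star p lam" "Ker_d2_star p lam"
    by (rule H2_subspace_quotient) (use assms in auto)
  note fin = card_cocycle_indices(1)[OF odd assms(2)]
  have Ker: "cocycle p i \<in> carrier (Ker_d2_star p lam)" if "i \<in> cocycle_indices p" for i
    using that by (rule cocycle_Ker[OF assms(2,1) two assms(3)])
  have add: "coordinate p lam i (v + w) = coordinate p lam i v + coordinate p lam i w"
    if "i \<in> cocycle_indices p" "v \<in> carrier (Ker_d2_star p lam)" "w \<in> carrier (Ker_d2_star p lam)" for i v w
    by (rule coordinate_linear)
  have scale: "coordinate p lam i (rscale c v) = c * coordinate p lam i v"
    if "i \<in> cocycle_indices p" "v \<in> carrier (Ker_d2_star p lam)" for i c v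
    by (rule coordinate_linear)
  have dual: "coordinate p lam i (cocycle p j) = (if i = j then 1 else 0)"
    if "i \<in> cocycle_indices p" "j \<in> cocycle_indices p" for i j
    using that by (rule coordinate_cocycle[OF assms(2) two])
  have coboundary: "coordinate p lam i v = 0" if "i \<in> cocycle_indices p" "v \<in> Im_d1_star p lam" for i v
    using that by (rule coordinate_coboundary[OF assms(2)])
  have separate: "v \<in> Im_d1_star p lam"
    if "v \<in> carrier (Ker_d2_star p lam)" "\<And>i. i \<in> cocycle_indices p \<Longrightarrow> coordinate p lam i v = 0" for v
    using that by (rule coordinates_separate[OF assms(2) odd two assms(3)])
  have basis: "vectorspace.basis (class_ring :: 'a ring) Q (cls ` cocycle p ` cocycle_indices p)"
    by (rule basis_of_dual_functionals(1)[where \<kappa> = "coordinate p lam"]) (fact fin Ker add scale dual coboundary separate)+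
  have dim: "vectorspace.dim (class_ring :: 'a ring) Q = card (cocycle_indices p)"
    by (rule basis_of_dual_functionals(2)[where \<kappa> = "coordinate p lam"]) (fact fin Ker add scale dual coboundary separate)+
  have inj: "inj_on cls (cocycle p ` cocycle_indices p)"
    by (rule basis_of_dual_functionals(3)[where \<kappa> = "coordinate p lam"]) (fact fin Ker add scale dual coboundary separate)+
  have cohom: "cohom_class p lam = cls"
    by (simp add: fun_eq_iff cohom_class_def)
  show ?thesis
    unfolding basis_cocycles_eq[OF assms(2) odd two] cohom H2_star_def
  proof (intro conjI)
    show "cocycle p ` cocycle_indices p \<subseteq> carrier (Ker_d2_star p lam)"
      using Ker by (rule image_subsetI)
    show "vectorspace.dim (class_ring :: 'a ring) Q = 3 * p - 1"
      unfolding dim by (rule card_cocycle_indices(2)[OF odd assms(2)])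
  qed (rule Q_vectorspace inj basis)+
qed

end
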